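(* Let $G\in\mathcal{G}_1$ be a Lie group with Lie algebra $\mathfrak{g}$, and let $b\in\mathfrak{g}$ and a commutative ideal $\mathfrak{u}\subset\mathfrak{g}$ of codimension one be such that $[b,z]=z$ for any $z\in\mathfrak{u}$. Suppose that $F(x,y)=\sqrt{g(y,y)}+g(X(x),y)$ is a left invariant Randers metric defined by a left invariant Riemannian metric $g$ and a left invariant vector field $X$ on $G$. Then $F$ is of Douglas type if and only if $X\in\mathrm{span}\{b\}$.
   Context: $\mathcal{G}_1$ is the family of non-commutative Lie groups $G$ with Lie algebra $\mathfrak{g}$ such that for any $x,y\in\mathfrak{g}$ the bracket $[x,y]$ is a linear combination of $x$ and $y$. It is known (Milnor) that for $G\in\mathcal{G}_1$ there exist an element $b\in\mathfrak{g}$ and a commutative ideal $\mathfrak{u}$ of codimension one with $[b,z]=z$ for any $z\in\mathfrak{u}$. A Finsler metric on a manifold $M$ is a function $F:TM\to[0,\infty)$, smooth on $TM\setminus\{0\}$, with $F(x,\lambda y)=\lambda F(x,y)$ for $\lambda>0$, and with $(g_{ij})=\left(\frac12\frac{\partial^2F^2}{\partial y^i\partial y^j}\right)$ positive definite on $TM\setminus\{0\}$. On a Lie group with identity $e$, $F$ is left invariant if $F(x,y)=F(e,dl_{x^{-1}}y)$. The Randers metric above is a Finsler metric if and only if $\sqrt{g(X,X)}<1$. The spray coefficients of $F$ are $G^i=\frac14 g^{il}\left([F^2]_{x^my^l}y^m-[F^2]_{x^l}\right)$, with $(g^{il})$ the inverse of $(g_{ij})$. $F$ is of Douglas type if in any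 standard local coordinate system of $TM$ one has $G^i=\frac12\Gamma^i_{jk}(x)y^jy^k+P(x,y)y^i$, where $P(x,y)$ is a local positively homogeneous function of degree one on $TM$.
   Formalization: The formal theorem additionally assumes that b is nonzero and g-orthogonal to the ideal u; without orthogonality the claim fails (X=εb with b not orthogonal to u is not Douglas), and b≠0 matters only in dimension one. *)

theory Defs
  imports
    "HOL-Analysis.Analysis"
    "HOL-Algebra.Group"
    "HOL-Library.Function_Algebras"
begin

section \<open>Pointwise real vector space structure on functions\<close>

text \<open>
  Tangent vectors and vector fields are encoded below as functions. This instance makes
  \<open>subspace\<close>, \<open>span\<close> and \<open>dim\<close> available for them.
\<close>

instantiation "fun" :: (type, real_vector) real_vector
begin

definition scaleR_fun_def: "r *\<^sub>R f = (\<lambda>x. r *\<^sub>R f x)"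

instance
  by standard
    (simp_all add: scaleR_fun_def fun_eq_iff scaleR_add_right scaleR_add_left)

end


section \<open>Smooth functions on open subsets of Euclidean spaces\<close>

primrec C_on :: "nat \<Rightarrow> 'e::euclidean_space set \<Rightarrow> ('e \<Rightarrow> 'f::real_normed_vector) \<Rightarrow> bool" where
  "C_on 0 S f \<longleftrightarrow> continuous_on S f"
| "C_on (Suc k) S f \<longleftrightarrow> (\<forall>x\<in>S. f differentiable (at x)) \<and>
     (\<forall>i\<in>Basis. C_on k S (\<lambda>x. frechet_derivative f (at x) i))"

text \<open>Only used for open \<open>S\<close>.\<close>

definition smooth_on :: "'e::euclidean_space set \<Rightarrow> ('e \<Rightarrow> 'f::real_normed_vector) \<Rightarrow> bool" where
  "smooth_on S f \<longleftrightarrow> (\<forall>k. C_on k S f)"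


section \<open>Smooth manifolds\<close>

text \<open>
  A chart is a pair of its domain and its coordinate map; the values of the map outside the
  domain are irrelevant.
\<close>

type_synonym ('a, 'e) chart = "'a set \<times> ('a \<Rightarrow> 'e)"

abbreviation cdom :: "('a, 'e) chart \<Rightarrow> 'a set" where "cdom \<equiv> fst"
abbreviation cmap :: "('a, 'e) chart \<Rightarrow> 'a \<Rightarrow> 'e" where "cmap \<equiv> snd"
abbreviation cran :: "('a, 'e) chart \<Rightarrow> 'e set" where "cran c \<equiv> cmap c ` cdom c"
abbreviation cinv :: "('a, 'e) chart \<Rightarrow> 'e \<Rightarrow> 'a" where "cinv c \<equiv> inv_into (cdom c) (cmap c)"

definition is_chart :: "'a topology \<Rightarrow> ('a, 'e::euclidean_space) chart \<Rightarrow> bool" where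
  "is_chart T c \<longleftrightarrow> openin T (cdom c) \<and> open (cran c) \<and>
     homeomorphic_map (subtopology T (cdom c)) (top_of_set (cran c)) (cmap c)"

definition compatible_charts ::
    "('a, 'e::euclidean_space) chart \<Rightarrow> ('a, 'e) chart \<Rightarrow> bool" where
  "compatible_charts c d \<longleftrightarrow>
     smooth_on (cmap c ` (cdom c \<inter> cdom d)) (cmap d \<circ> cinv c) \<and>
     smooth_on (cmap d ` (cdom c \<inter> cdom d)) (cmap c \<circ> cinv d)"

text \<open>
  The smooth structure \<open>A\<close> is a maximal atlas, so that a condition on all charts in \<open>A\<close> is a
  condition on all local coordinate systems.
\<close>

locale smooth_manifold =
  fixes T :: "'a topology" and A :: "('a, 'e::euclidean_space) chart set"
  assumes Hausdorff: "Hausdorff_space T"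
    and second_countable: "second_countable T"
    and charts: "c \<in> A \<Longrightarrow> is_chart T c"
    and cover: "(\<Union>c\<in>A. cdom c) = topspace T"
    and compatible: "c \<in> A \<Longrightarrow> d \<in> A \<Longrightarrow> compatible_charts c d"
    and maximal: "is_chart T c \<Longrightarrow> (\<And>d. d \<in> A \<Longrightarrow> compatible_charts c d) \<Longrightarrow> c \<in> A"

definition smooth_map ::
    "'a topology \<Rightarrow> ('a, 'e::euclidean_space) chart set \<Rightarrow>
     'b topology \<Rightarrow> ('b, 'f::euclidean_space) chart set \<Rightarrow> ('a \<Rightarrow> 'b) \<Rightarrow> bool" where
  "smooth_map T A S B f \<longleftrightarrow> continuous_map T S f \<and>
     (\<forall>c\<in>A. \<forall>d\<in>B. smooth_on (cmap c ` {x \<in> cdom c. f x \<in> cdom d}) (cmap d \<circ> f \<circ> cinv c))"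

definition prod_atlas ::
    "('a, 'e) chart set \<Rightarrow> ('b, 'f) chart set \<Rightarrow> ('a \<times> 'b, 'e \<times> 'f) chart set" where
  "prod_atlas A B = {(cdom c \<times> cdom d, map_prod (cmap c) (cmap d)) | c d. c \<in> A \<and> d \<in> B}"


section \<open>Tangent vectors and vector fields\<close>

text \<open>
  A tangent vector at \<open>x\<close> is the family of its coordinate vectors in the charts around \<open>x\<close>,
  related by the derivatives of the transition maps. The family is \<open>0\<close> at all other charts, so
  that the tangent space is a linear subspace of the function type.
\<close>

type_synonym ('a, 'e) tangent = "('a, 'e) chart \<Rightarrow> 'e"

definition tangent_space ::
    "('a, 'e::euclidean_space) chart set \<Rightarrow> 'a \<Rightarrow> ('a, 'e) tangent set" where
  "tangent_space A x = {v.
     (\<forall>c\<in>A. \<forall>d\<in>A. x \<in> cdom c \<inter> cdom d \<longrightarrow>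
        v d = frechet_derivative (cmap d \<circ> cinv c) (at (cmap c x)) (v c)) \<and>
     (\<forall>c. \<not> (c \<in> A \<and> x \<in> cdom c) \<longrightarrow> v c = 0)}"

text \<open>The tangent vector at \<open>x\<close> with coordinate vector \<open>y\<close> in the chart \<open>c\<close>.\<close>

definition coord_vec ::
    "('a, 'e::euclidean_space) chart set \<Rightarrow> ('a, 'e) chart \<Rightarrow> 'a \<Rightarrow> 'e \<Rightarrow> ('a, 'e) tangent" where
  "coord_vec A c x y = (\<lambda>d. if d \<in> A \<and> x \<in> cdom d
     then frechet_derivative (cmap d \<circ> cinv c) (at (cmap c x)) y else 0)"

text \<open>On tangent vectors and smooth maps the result does not depend on the chart chosen at \<open>x\<close>.\<close>

definition differential ::
    "('a, 'e::euclidean_space) chart set \<Rightarrow> ('b, 'f::euclidean_space) chart set \<Rightarrow>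
     ('a \<Rightarrow> 'b) \<Rightarrow> 'a \<Rightarrow> ('a, 'e) tangent \<Rightarrow> ('b, 'f) tangent" where
  "differential A B f x v = (let c = (SOME c. c \<in> A \<and> x \<in> cdom c) in
     (\<lambda>d. if d \<in> B \<and> f x \<in> cdom d
       then frechet_derivative (cmap d \<circ> f \<circ> cinv c) (at (cmap c x)) (v c) else 0))"

text \<open>Smooth vector fields, extended by \<open>0\<close> outside of the manifold.\<close>

definition vector_field ::
    "('a, 'e::euclidean_space) chart set \<Rightarrow> ('a \<Rightarrow> ('a, 'e) tangent) \<Rightarrow> bool" where
  "vector_field A X \<longleftrightarrow>
     (\<forall>x\<in>(\<Union>c\<in>A. cdom c). X x \<in> tangent_space A x) \<and>
     (\<forall>x. x \<notin> (\<Union>c\<in>A. cdom c) \<longrightarrow> X x = 0) \<and>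
     (\<forall>c\<in>A. smooth_on (cran c) (\<lambda>p. X (cinv c p) c))"

text \<open>In coordinates, the \<open>i\<close>-th component of \<open>[X, Y]\<close> is
  \<open>\<Sum>j. X\<^sup>j \<partial>\<^sub>j Y\<^sup>i - Y\<^sup>j \<partial>\<^sub>j X\<^sup>i\<close>.\<close>

definition lie_bracket ::
    "('a, 'e::euclidean_space) chart set \<Rightarrow> ('a \<Rightarrow> ('a, 'e) tangent) \<Rightarrow>
     ('a \<Rightarrow> ('a, 'e) tangent) \<Rightarrow> ('a \<Rightarrow> ('a, 'e) tangent)" where
  "lie_bracket A X Y = (\<lambda>x c. if c \<in> A \<and> x \<in> cdom c
     then frechet_derivative (\<lambda>p. Y (cinv c p) c) (at (cmap c x)) (X x c)
        - frechet_derivative (\<lambda>p. X (cinv c p) c) (at (cmap c x)) (Y x c)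
     else 0)"


section \<open>Lie groups and their Lie algebras\<close>

locale lie_group = group G + smooth_manifold T A
  for G (structure) and T :: "'a topology" and A :: "('a, 'e::euclidean_space) chart set" +
  assumes topspace_eq: "topspace T = carrier G"
    and smooth_mult:
      "smooth_map (prod_topology T T) (prod_atlas A A) T A (\<lambda>(x, y). x \<otimes> y)"
    and smooth_inv: "smooth_map T A T A (\<lambda>x. inv x)"

definition left_invariant_field ::
    "('a, 'm) monoid_scheme \<Rightarrow> ('a, 'e::euclidean_space) chart set \<Rightarrow>
     ('a \<Rightarrow> ('a, 'e) tangent) \<Rightarrow> bool" where
  "left_invariant_field G A X \<longleftrightarrow> vector_field A X \<and>
     (\<forall>a\<in>carrier G. \<forall>x\<in>carrier G.
        differential A A (\<lambda>z. a \<otimes>\<^bsub>G\<^esub> z) x (X x) = X (a \<otimes>\<^bsub>G\<^esub> x))"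

text \<open>The Lie algebra is the space of left invariant vector fields with \<open>lie_bracket A\<close>.\<close>

definition lie_algebra ::
    "('a, 'm) monoid_scheme \<Rightarrow> ('a, 'e::euclidean_space) chart set \<Rightarrow>
     ('a \<Rightarrow> ('a, 'e) tangent) set" where
  "lie_algebra G A = {X. left_invariant_field G A X}"

definition class_G1 ::
    "('a, 'm) monoid_scheme \<Rightarrow> 'a topology \<Rightarrow> ('a, 'e::euclidean_space) chart set \<Rightarrow> bool" where
  "class_G1 G T A \<longleftrightarrow> lie_group G T A \<and> \<not> comm_group G \<and>
     (\<forall>x\<in>lie_algebra G A. \<forall>y\<in>lie_algebra G A. lie_bracket A x y \<in> span {x, y})"

definition lie_ideal ::
    "('a, 'm) monoid_scheme \<Rightarrow> ('a, 'e::euclidean_space) chart set \<Rightarrow>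
     ('a \<Rightarrow> ('a, 'e) tangent) set \<Rightarrow> bool" where
  "lie_ideal G A U \<longleftrightarrow> subspace U \<and> U \<subseteq> lie_algebra G A \<and>
     (\<forall>x\<in>lie_algebra G A. \<forall>z\<in>U. lie_bracket A x z \<in> U)"

definition commutative_subset ::
    "('a, 'e::euclidean_space) chart set \<Rightarrow> ('a \<Rightarrow> ('a, 'e) tangent) set \<Rightarrow> bool" where
  "commutative_subset A U \<longleftrightarrow> (\<forall>z\<in>U. \<forall>w\<in>U. lie_bracket A z w = 0)"

text \<open>\<open>dim\<close> is the honest dimension here: Lie algebras of Lie groups are finite-dimensional.\<close>

definition codim_one ::
    "('a, 'm) monoid_scheme \<Rightarrow> ('a, 'e::euclidean_space) chart set \<Rightarrow>
     ('a \<Rightarrow> ('a, 'e) tangent) set \<Rightarrow> bool" where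
  "codim_one G A U \<longleftrightarrow> dim (lie_algebra G A) = dim U + 1"


section \<open>Riemannian metrics\<close>

definition riemannian_metric ::
    "('a, 'e::euclidean_space) chart set \<Rightarrow>
     ('a \<Rightarrow> ('a, 'e) tangent \<Rightarrow> ('a, 'e) tangent \<Rightarrow> real) \<Rightarrow> bool" where
  "riemannian_metric A g \<longleftrightarrow>
     (\<forall>x\<in>(\<Union>c\<in>A. cdom c).
        (\<forall>v\<in>tangent_space A x. \<forall>w\<in>tangent_space A x. g x v w = g x w v) \<and>
        (\<forall>u\<in>tangent_space A x. \<forall>v\<in>tangent_space A x. \<forall>w\<in>tangent_space A x. \<forall>r.
           g x (r *\<^sub>R u + v) w = r * g x u w + g x v w) \<and>
        (\<forall>v\<in>tangent_space A x. v \<noteq> 0 \<longrightarrow> g x v v > 0)) \<and>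
     (\<forall>c\<in>A. \<forall>i\<in>Basis. \<forall>j\<in>Basis.
        smooth_on (cran c) (\<lambda>p. g (cinv c p) (coord_vec A c (cinv c p) i) (coord_vec A c (cinv c p) j)))"

definition left_invariant_riemannian_metric ::
    "('a, 'm) monoid_scheme \<Rightarrow> ('a, 'e::euclidean_space) chart set \<Rightarrow>
     ('a \<Rightarrow> ('a, 'e) tangent \<Rightarrow> ('a, 'e) tangent \<Rightarrow> real) \<Rightarrow> bool" where
  "left_invariant_riemannian_metric G A g \<longleftrightarrow> riemannian_metric A g \<and>
     (\<forall>a\<in>carrier G. \<forall>x\<in>carrier G. \<forall>v\<in>tangent_space A x. \<forall>w\<in>tangent_space A x.
        g (a \<otimes>\<^bsub>G\<^esub> x) (differential A A (\<lambda>z. a \<otimes>\<^bsub>G\<^esub> z) x v) (differential A A (\<lambda>z. a \<otimes>\<^bsub>G\<^esub> z) x w)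
          = g x v w)"


section \<open>Finsler metrics, sprays and Douglas type\<close>

definition partial :: "'n::finite \<Rightarrow> (real ^ 'n \<Rightarrow> real) \<Rightarrow> real ^ 'n \<Rightarrow> real" where
  "partial i f p = deriv (\<lambda>t. f (p + t *\<^sub>R axis i 1)) 0"

text \<open>\<open>F\<close> in the standard local coordinates \<open>(p, y)\<close> of the tangent bundle induced by \<open>c\<close>.\<close>

definition local_rep ::
    "('a, 'e::euclidean_space) chart set \<Rightarrow> ('a \<Rightarrow> ('a, 'e) tangent \<Rightarrow> real) \<Rightarrow>
     ('a, 'e) chart \<Rightarrow> 'e \<Rightarrow> 'e \<Rightarrow> real" where
  "local_rep A F c p y = F (cinv c p) (coord_vec A c (cinv c p) y)"

definition fundamental_tensor ::
    "('a, real ^ 'n) chart set \<Rightarrow> ('a \<Rightarrow> ('a, real ^ 'n) tangent \<Rightarrow> real) \<Rightarrow>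
     ('a, real ^ 'n) chart \<Rightarrow> real ^ 'n \<Rightarrow> real ^ 'n \<Rightarrow> real ^ 'n ^ 'n" where
  "fundamental_tensor A F c p y =
     (\<chi> i j. 1/2 * partial i (partial j (\<lambda>y'. (local_rep A F c p y')\<^sup>2)) y)"

definition finsler_metric ::
    "('a, real ^ 'n) chart set \<Rightarrow> ('a \<Rightarrow> ('a, real ^ 'n) tangent \<Rightarrow> real) \<Rightarrow> bool" where
  "finsler_metric A F \<longleftrightarrow>
     (\<forall>x\<in>(\<Union>c\<in>A. cdom c). \<forall>v\<in>tangent_space A x.
        F x v \<ge> 0 \<and> (\<forall>r>0. F x (r *\<^sub>R v) = r * F x v)) \<and>
     (\<forall>c\<in>A. smooth_on (cran c \<times> - {0}) (\<lambda>(p, y). local_rep A F c p y)) \<and>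
     (\<forall>c\<in>A. \<forall>p\<in>cran c. \<forall>y. y \<noteq> 0 \<longrightarrow>
        (\<forall>w. w \<noteq> 0 \<longrightarrow> w \<bullet> (fundamental_tensor A F c p y *v w) > 0))"

definition left_invariant_finsler ::
    "('a, 'm) monoid_scheme \<Rightarrow> ('a, 'e::euclidean_space) chart set \<Rightarrow>
     ('a \<Rightarrow> ('a, 'e) tangent \<Rightarrow> real) \<Rightarrow> bool" where
  "left_invariant_finsler G A F \<longleftrightarrow>
     (\<forall>x\<in>carrier G. \<forall>y\<in>tangent_space A x.
        F x y = F \<one>\<^bsub>G\<^esub> (differential A A (\<lambda>z. inv\<^bsub>G\<^esub> x \<otimes>\<^bsub>G\<^esub> z) x y))"

definition randers ::
    "('a \<Rightarrow> ('a, 'e) tangent \<Rightarrow> ('a, 'e) tangent \<Rightarrow> real) \<Rightarrow> ('a \<Rightarrow> ('a, 'e) tangent) \<Rightarrow>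
     'a \<Rightarrow> ('a, 'e) tangent \<Rightarrow> real" where
  "randers g X x y = sqrt (g x y y) + g x (X x) y"

text \<open>\<open>G\<^sup>i = 1/4 \<Sum>l. g\<^sup>i\<^sup>l (\<Sum>m. [F\<^sup>2]\<^bsub>x^m y^l\<^esub> y\<^sup>m - [F\<^sup>2]\<^bsub>x^l\<^esub>)\<close>\<close>

definition spray ::
    "('a, real ^ 'n) chart set \<Rightarrow> ('a \<Rightarrow> ('a, real ^ 'n) tangent \<Rightarrow> real) \<Rightarrow>
     ('a, real ^ 'n) chart \<Rightarrow> 'n \<Rightarrow> real ^ 'n \<Rightarrow> real ^ 'n \<Rightarrow> real" where
  "spray A F c i p y = 1/4 * (\<Sum>l\<in>UNIV. matrix_inv (fundamental_tensor A F c p y) $ i $ l *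
     ((\<Sum>m\<in>UNIV. partial m (\<lambda>p'. partial l (\<lambda>y'. (local_rep A F c p' y')\<^sup>2) y) p * y $ m)
        - partial l (\<lambda>p'. (local_rep A F c p' y)\<^sup>2) p))"

text \<open>
  Spray coefficients live on the slit tangent bundle, hence \<open>y \<noteq> 0\<close>. No regularity of
  \<open>\<Gamma>\<close> and \<open>P\<close> is required.
\<close>

definition douglas ::
    "('a, real ^ 'n) chart set \<Rightarrow> ('a \<Rightarrow> ('a, real ^ 'n) tangent \<Rightarrow> real) \<Rightarrow> bool" where
  "douglas A F \<longleftrightarrow> (\<forall>c\<in>A.
     \<exists>(\<Gamma> :: real ^ 'n \<Rightarrow> 'n \<Rightarrow> 'n \<Rightarrow> 'n \<Rightarrow> real) (P :: real ^ 'n \<Rightarrow> real ^ 'n \<Rightarrow> real).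
       (\<forall>p\<in>cran c. \<forall>y r. y \<noteq> 0 \<longrightarrow> r > 0 \<longrightarrow> P p (r *\<^sub>R y) = r * P p y) \<and>
       (\<forall>p\<in>cran c. \<forall>y i. y \<noteq> 0 \<longrightarrow>
          spray A F c i p y
            = 1/2 * (\<Sum>j\<in>UNIV. \<Sum>k\<in>UNIV. \<Gamma> p i j k * y $ j * y $ k) + P p y * y $ i))"

end

theory Submission
  imports Defs
begin

text \<open>
  Write \<open>\<alpha>\<close> for the norm of \<open>g\<close> and \<open>\<beta> = g(X, \<cdot>)\<close>, so that \<open>F = \<alpha> + \<beta>\<close>. The equivalence goes through the
  condition that the one-form \<open>\<beta>\<close> is closed.

  That \<open>F\<close> is of Douglas type if and only if \<open>\<beta>\<close> is closed is a local fact about Randers metrics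
  (\<open>douglas_iff_closed\<close>). It rests on the explicit spray (\<open>spray_formula\<close>): the spray of \<open>F\<close> is the
  geodesic spray of \<open>g\<close>, plus a multiple of \<open>y\<close>, plus \<open>\<alpha>/2\<close> times the vector that corresponds to
  \<open>d\<beta>(y, \<cdot>)\<close> under \<open>g\<close>. The first term is quadratic in \<open>y\<close> and the second is allowed in a Douglas metric.
  The third is odd in \<open>y\<close> whereas quadratic forms are even, and it is orthogonal to \<open>y\<close>; so it can be
  matched by a quadratic form and a radial term only if it vanishes, that is, only if \<open>d\<beta> = 0\<close>.

  Closedness is then translated into the Lie algebra. For left invariant fields \<open>Y\<close>, \<open>Z\<close> one has
  \<open>d\<beta>(Y, Z) = - g(X, [Y, Z])\<close> (\<open>form_derivative_bracket\<close>). Left invariant fields span every tangent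
  space, and each is of the form \<open>r b + z\<close> with \<open>z \<in> U\<close> (\<open>equivariant_decomposition\<close>). The brackets
  of \<open>b\<close> and the elements of \<open>U\<close> lie in \<open>U\<close>, and every \<open>z \<in> U\<close> is the bracket \<open>[b, z]\<close>. So \<open>\<beta>\<close> is closed
  exactly when \<open>X\<close> is orthogonal to \<open>U\<close>. Since \<open>b\<close> is orthogonal to \<open>U\<close> and \<open>U\<close> has codimension one, this
  means that \<open>X\<close> is a multiple of \<open>b\<close>.

  The decomposition rests on the Lie algebra having the dimension of the group, hence on the
  smoothness of enough left invariant fields. This is obtained from the smoothness of the
  multiplication as a function of both factors (\<open>extend_basis_in_lie_algebra\<close>).
\<close>

section \<open>Charts and the chain rule on a manifold\<close>

lemma smooth_on_imp_differentiable:
  "smooth_on S f \<Longrightarrow> x \<in> S \<Longrightarrow> f differentiable (at x)"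
  unfolding smooth_on_def by (metis C_on.simps(2))

lemma frechet_has_derivative:
  "f differentiable (at x) \<Longrightarrow> (f has_derivative frechet_derivative f (at x)) (at x)"
  by (simp add: frechet_derivative_works)

lemma has_derivative_eq_on_open:
  assumes "open S" "x \<in> S" "\<And>y. y \<in> S \<Longrightarrow> f y = g y" "(f has_derivative f') (at x)"
  shows "(g has_derivative f') (at x)"
  using has_derivative_transform_within_open[OF assms(4,1,2,3)] .

context smooth_manifold
begin

lemma openin_cdom: "c \<in> A \<Longrightarrow> openin T (cdom c)"
  using charts unfolding is_chart_def by blast

lemma open_cran: "c \<in> A \<Longrightarrow> open (cran c)"
  using charts unfolding is_chart_def by blast

lemma inj_cmap:
  assumes "c \<in> A" shows "inj_on (cmap c) (cdom c)"
proof -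
  have "topspace (subtopology T (cdom c)) = cdom c"
    using openin_cdom[OF assms] openin_subset by (metis topspace_subtopology_subset)
  moreover have "homeomorphic_map (subtopology T (cdom c)) (top_of_set (cran c)) (cmap c)"
    using charts[OF assms] unfolding is_chart_def by blast
  ultimately show ?thesis
    using homeomorphic_imp_injective_map by metis
qed

lemma cinv_cmap [simp]: "c \<in> A \<Longrightarrow> x \<in> cdom c \<Longrightarrow> cinv c (cmap c x) = x"
  by (simp add: inj_cmap)

lemma cinv_in_cdom: "p \<in> cran c \<Longrightarrow> cinv c p \<in> cdom c"
  by (rule inv_into_into)

lemma cmap_cinv: "p \<in> cran c \<Longrightarrow> cmap c (cinv c p) = p"
  by (rule f_inv_into_f)

lemma open_chart_image:
  assumes "c \<in> A" "openin T V" "V \<subseteq> cdom c"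
  shows "open (cmap c ` V)"
proof -
  have "open_map (subtopology T (cdom c)) (top_of_set (cran c)) (cmap c)"
    using charts[OF assms(1)] homeomorphic_imp_open_map unfolding is_chart_def by blast
  moreover have "openin (subtopology T (cdom c)) V"
    using assms unfolding openin_subtopology by blast
  ultimately have "openin (top_of_set (cran c)) (cmap c ` V)"
    unfolding open_map_def by blast
  then show ?thesis
    using open_cran[OF assms(1)] openin_open_eq by blast
qed

lemma chart_at: "x \<in> topspace T \<Longrightarrow> \<exists>c\<in>A. x \<in> cdom c"
  using cover by blast

lemma cdom_subset: "c \<in> A \<Longrightarrow> x \<in> cdom c \<Longrightarrow> x \<in> topspace T"
  using cover by blast

text \<open>
  Weaker than a smooth map, but exactly what pushing tangent vectors forward and composing the
  pushforwards requires.
\<close>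

definition differentiable_map :: "('a \<Rightarrow> 'a) \<Rightarrow> bool" where
  "differentiable_map f \<longleftrightarrow> continuous_map T T f \<and>
     (\<forall>c\<in>A. \<forall>d\<in>A. \<forall>x\<in>cdom c. f x \<in> cdom d \<longrightarrow>
        (cmap d \<circ> f \<circ> cinv c) differentiable (at (cmap c x)))"

lemma differentiable_mapD:
  "differentiable_map f \<Longrightarrow> c \<in> A \<Longrightarrow> d \<in> A \<Longrightarrow> x \<in> cdom c \<Longrightarrow> f x \<in> cdom d \<Longrightarrow>
     (cmap d \<circ> f \<circ> cinv c) differentiable (at (cmap c x))"
  unfolding differentiable_map_def by blast

lemma differentiable_map_topspace:
  "differentiable_map f \<Longrightarrow> x \<in> topspace T \<Longrightarrow> f x \<in> topspace T"
  unfolding differentiable_map_def continuous_map_def by blast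

lemma differentiable_map_id: "differentiable_map (\<lambda>z. z)"
proof -
  have "(cmap d \<circ> cinv c) differentiable (at (cmap c x))"
    if "c \<in> A" "d \<in> A" "x \<in> cdom c" "x \<in> cdom d" for c d x
    using compatible[OF that(1,2)] that smooth_on_imp_differentiable
    unfolding compatible_charts_def by blast
  then show ?thesis
    unfolding differentiable_map_def by (simp add: comp_def)
qed

lemma openin_chart_preimage:
  assumes "continuous_map T T f" "c \<in> A" "d \<in> A"
  shows "openin T {z \<in> cdom c. f z \<in> cdom d}"
proof -
  have "openin T {z \<in> topspace T. f z \<in> cdom d}"
    using assms openin_cdom unfolding continuous_map_def by blast
  then have "openin T (cdom c \<inter> {z \<in> topspace T. f z \<in> cdom d})"
    using assms openin_cdom by blast
  moreover have "cdom c \<inter> {z \<in> topspace T. f z \<in> cdom d} = {z \<in> cdom c. f z \<in> cdom d}"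
    using cdom_subset assms by blast
  ultimately show ?thesis by simp
qed

text \<open>
  The manifold need not exhaust its type. Asking the composite to agree with \<open>k\<close> only on the manifold
  makes the rule applicable to identities such as \<open>a (x z) = (a x) z\<close>, which hold on the carrier of a
  group only.
\<close>

lemma chart_chain_rule:
  assumes f: "differentiable_map f" and h: "differentiable_map h"
    and k: "\<And>z. z \<in> topspace T \<Longrightarrow> k z = h (f z)"
    and c: "c \<in> A" "x \<in> cdom c" and d: "d \<in> A" "f x \<in> cdom d" and e: "e \<in> A" "h (f x) \<in> cdom e"
  shows "((cmap e \<circ> k \<circ> cinv c) has_derivative
     (\<lambda>v. frechet_derivative (cmap e \<circ> h \<circ> cinv d) (at (cmap d (f x)))
        (frechet_derivative (cmap d \<circ> f \<circ> cinv c) (at (cmap c x)) v))) (at (cmap c x))"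
proof -
  let ?N = "{z \<in> cdom c. f z \<in> cdom d}"
  have f': "((cmap d \<circ> f \<circ> cinv c) has_derivative
      frechet_derivative (cmap d \<circ> f \<circ> cinv c) (at (cmap c x))) (at (cmap c x))"
    using differentiable_mapD[OF f c(1) d(1) c(2) d(2)] by (rule frechet_has_derivative)
  have h': "((cmap e \<circ> h \<circ> cinv d) has_derivative
      frechet_derivative (cmap e \<circ> h \<circ> cinv d) (at (cmap d (f x)))) (at (cmap d (f x)))"
    using differentiable_mapD[OF h d(1) e(1) d(2) e(2)] by (rule frechet_has_derivative)
  have eq: "(cmap d \<circ> f \<circ> cinv c) (cmap c x) = cmap d (f x)"
    using c by simp
  have "((cmap e \<circ> h \<circ> cinv d) \<circ> (cmap d \<circ> f \<circ> cinv c) has_derivative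
      frechet_derivative (cmap e \<circ> h \<circ> cinv d) (at (cmap d (f x))) \<circ>
      frechet_derivative (cmap d \<circ> f \<circ> cinv c) (at (cmap c x))) (at (cmap c x))"
    using diff_chain_at[OF f'] h' eq by simp
  then have *: "((cmap e \<circ> h \<circ> cinv d) \<circ> (cmap d \<circ> f \<circ> cinv c) has_derivative
      (\<lambda>v. frechet_derivative (cmap e \<circ> h \<circ> cinv d) (at (cmap d (f x)))
        (frechet_derivative (cmap d \<circ> f \<circ> cinv c) (at (cmap c x)) v))) (at (cmap c x))"
    by (simp only: comp_def)
  have "open (cmap c ` ?N)"
    using open_chart_image[OF c(1) openin_chart_preimage] f c d
    unfolding differentiable_map_def by blast
  moreover have "cmap c x \<in> cmap c ` ?N"
    using c d by blast
  moreover have "((cmap e \<circ> h \<circ> cinv d) \<circ> (cmap d \<circ> f \<circ> cinv c)) p = (cmap e \<circ> k \<circ> cinv c) p"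
    if p: "p \<in> cmap c ` ?N" for p
  proof -
    obtain z where z: "z \<in> cdom c" "f z \<in> cdom d" "p = cmap c z"
      using p by blast
    then have "k z = h (f z)"
      using k cdom_subset[OF c(1)] by blast
    then show ?thesis
      using z c(1) d(1) by simp
  qed
  ultimately show ?thesis
    using has_derivative_transform_within_open[OF *] by blast
qed

lemma chart_chain_rule_eq:
  assumes "differentiable_map f" "differentiable_map h"
    and "\<And>z. z \<in> topspace T \<Longrightarrow> k z = h (f z)"
    and "c \<in> A" "x \<in> cdom c" "d \<in> A" "f x \<in> cdom d" "e \<in> A" "h (f x) \<in> cdom e"
  shows "frechet_derivative (cmap e \<circ> k \<circ> cinv c) (at (cmap c x)) v =
     frechet_derivative (cmap e \<circ> h \<circ> cinv d) (at (cmap d (f x)))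
        (frechet_derivative (cmap d \<circ> f \<circ> cinv c) (at (cmap c x)) v)"
  by (rule fun_cong[OF frechet_derivative_at[OF chart_chain_rule[where f = f and h = h, OF assms]], symmetric])

lemma tangent_spaceD:
  assumes "v \<in> tangent_space A x" "c \<in> A" "d \<in> A" "x \<in> cdom c" "x \<in> cdom d"
  shows "v d = frechet_derivative (cmap d \<circ> (\<lambda>z. z) \<circ> cinv c) (at (cmap c x)) (v c)"
proof -
  have "v d = frechet_derivative (cmap d \<circ> cinv c) (at (cmap c x)) (v c)"
    using assms unfolding tangent_space_def by blast
  then show ?thesis
    by (simp only: comp_def)
qed

lemma tangent_space_zero_off:
  "v \<in> tangent_space A x \<Longrightarrow> \<not> (c \<in> A \<and> x \<in> cdom c) \<Longrightarrow> v c = 0"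
  unfolding tangent_space_def by blast

lemma tangent_space_eqI:
  assumes "v \<in> tangent_space A x" "w \<in> tangent_space A x" "c \<in> A" "x \<in> cdom c" "v c = w c"
  shows "v = w"
proof
  fix d
  \<comment> \<open>Transition derivatives carry the coordinates from \<open>c\<close> to every other chart at \<open>x\<close>.\<close>
  show "v d = w d"
  proof (cases "d \<in> A \<and> x \<in> cdom d")
    case True
    then show ?thesis
      using assms tangent_spaceD[of v x c d] tangent_spaceD[of w x c d] by simp
  next
    case False
    then show ?thesis
      using tangent_space_zero_off[OF assms(1)] tangent_space_zero_off[OF assms(2)] by simp
  qed
qed

lemma tangent_space_add_scale:
  assumes v: "v \<in> tangent_space A x" and w: "w \<in> tangent_space A x"
  shows "r *\<^sub>R v + w \<in> tangent_space A x"
proof -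
  have "(r *\<^sub>R v + w) d = frechet_derivative (cmap d \<circ> cinv c) (at (cmap c x)) ((r *\<^sub>R v + w) c)"
    if "c \<in> A" "d \<in> A" "x \<in> cdom c \<inter> cdom d" for c d
  proof -
    have "(cmap d \<circ> cinv c) differentiable (at (cmap c x))"
      using differentiable_mapD[OF differentiable_map_id that(1,2), of x] that by (simp add: comp_def)
    then have "linear (frechet_derivative (cmap d \<circ> cinv c) (at (cmap c x)))"
      by (rule linear_frechet_derivative)
    then show ?thesis
      using tangent_spaceD[OF v that(1,2)] tangent_spaceD[OF w that(1,2)] that(3)
      by (simp add: linear_add linear_scale scaleR_fun_def comp_def)
  qed
  moreover have "(r *\<^sub>R v + w) c = 0" if "\<not> (c \<in> A \<and> x \<in> cdom c)" for c
    using tangent_space_zero_off[OF v that] tangent_space_zero_off[OF w that]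
    by (simp add: scaleR_fun_def)
  ultimately show ?thesis
    unfolding tangent_space_def by blast
qed

lemma zero_in_tangent_space: "0 \<in> tangent_space A x"
proof -
  have "frechet_derivative (cmap d \<circ> cinv c) (at (cmap c x)) 0 = 0"
    if "c \<in> A" "d \<in> A" "x \<in> cdom c \<inter> cdom d" for c d
  proof -
    have "(cmap d \<circ> cinv c) differentiable (at (cmap c x))"
      using differentiable_mapD[OF differentiable_map_id that(1,2), of x] that by (simp add: comp_def)
    then have "linear (frechet_derivative (cmap d \<circ> cinv c) (at (cmap c x)))"
      by (rule linear_frechet_derivative)
    then show ?thesis
      by (simp add: linear_0)
  qed
  then show ?thesis
    unfolding tangent_space_def by auto
qed

lemma coord_vec_chart:
  assumes "c \<in> A" "x \<in> cdom c"
  shows "coord_vec A c x y c = y"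
proof -
  have "frechet_derivative (cmap c \<circ> cinv c) (at (cmap c x)) y = y"
  proof -
    have "((\<lambda>p. p) has_derivative (\<lambda>y. y)) (at (cmap c x))"
      by (rule has_derivative_ident)
    then have "((cmap c \<circ> cinv c) has_derivative (\<lambda>y. y)) (at (cmap c x))"
      by (rule has_derivative_transform_within_open[where s = "cran c"])
        (use assms open_cran in auto)
    then show ?thesis
      by (rule fun_cong[OF frechet_derivative_at, symmetric])
  qed
  then show ?thesis
    using assms unfolding coord_vec_def by simp
qed

lemma coord_vec_in_tangent_space:
  assumes c: "c \<in> A" "x \<in> cdom c"
  shows "coord_vec A c x y \<in> tangent_space A x"
proof -
  have "coord_vec A c x y d' =
      frechet_derivative (cmap d' \<circ> cinv d) (at (cmap d x)) (coord_vec A c x y d)"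
    if "d \<in> A" "d' \<in> A" "x \<in> cdom d \<inter> cdom d'" for d d'
    using chart_chain_rule_eq[OF differentiable_map_id differentiable_map_id, of "\<lambda>z. z" c x d d' y]
      that c unfolding coord_vec_def by (simp add: comp_def)
  moreover have "coord_vec A c x y d = 0" if "\<not> (d \<in> A \<and> x \<in> cdom d)" for d
    using that unfolding coord_vec_def by auto
  ultimately show ?thesis
    unfolding tangent_space_def by blast
qed

lemma coord_vec_of_tangent:
  assumes "c \<in> A" "x \<in> cdom c" "v \<in> tangent_space A x"
  shows "coord_vec A c x (v c) = v"
  by (rule tangent_space_eqI[OF coord_vec_in_tangent_space[OF assms(1,2)] assms(3,1,2)
        coord_vec_chart[OF assms(1,2)]])

lemma coord_vec_add_scale:
  assumes "c \<in> A" "x \<in> cdom c"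
  shows "coord_vec A c x (r *\<^sub>R y + w) = r *\<^sub>R coord_vec A c x y + coord_vec A c x w"
  using assms
  by (intro tangent_space_eqI[of _ x _ c] tangent_space_add_scale coord_vec_in_tangent_space)
    (simp_all add: coord_vec_chart scaleR_fun_def)

text \<open>
  The definition of the differential picks an arbitrary chart at \<open>x\<close>; by the chain rule, applied to a
  change of charts followed by \<open>f\<close>, every chart gives the same vector.
\<close>

lemma differential_in_chart:
  assumes f: "differentiable_map f" and v: "v \<in> tangent_space A x"
    and c: "c \<in> A" "x \<in> cdom c" and d: "d \<in> A" "f x \<in> cdom d"
  shows "differential A A f x v d =
    frechet_derivative (cmap d \<circ> f \<circ> cinv c) (at (cmap c x)) (v c)"
proof -
  define c' where "c' = (SOME c. c \<in> A \<and> x \<in> cdom c)"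
  have c': "c' \<in> A" "x \<in> cdom c'"
    using someI[of "\<lambda>c. c \<in> A \<and> x \<in> cdom c" c] c unfolding c'_def by blast+
  have "frechet_derivative (cmap d \<circ> f \<circ> cinv c') (at (cmap c' x)) (v c') =
      frechet_derivative (cmap d \<circ> f \<circ> cinv c) (at (cmap c x)) (v c)"
    using chart_chain_rule_eq[OF differentiable_map_id f, of f c' x c d "v c'"]
      tangent_spaceD[OF v c'(1) c(1) c'(2) c(2)] c c' d by simp
  then show ?thesis
    using d unfolding differential_def by (simp add: Let_def flip: c'_def)
qed

lemma differential_in_tangent_space:
  assumes f: "differentiable_map f" and v: "v \<in> tangent_space A x" and x: "x \<in> topspace T"
  shows "differential A A f x v \<in> tangent_space A (f x)"
proof -
  obtain c where c: "c \<in> A" "x \<in> cdom c"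
    using chart_at x by blast
  have "differential A A f x v d' = frechet_derivative (cmap d' \<circ> cinv d) (at (cmap d (f x)))
      (differential A A f x v d)"
    if "d \<in> A" "d' \<in> A" "f x \<in> cdom d \<inter> cdom d'" for d d'
    using chart_chain_rule_eq[OF f differentiable_map_id, of f c x d d' "v c"]
      differential_in_chart[OF f v c] that c by (simp add: comp_def)
  moreover have "differential A A f x v d = 0" if "\<not> (d \<in> A \<and> f x \<in> cdom d)" for d
    using that unfolding differential_def by (auto simp: Let_def)
  ultimately show ?thesis
    unfolding tangent_space_def by blast
qed

lemma differential_compose:
  assumes f: "differentiable_map f" and h: "differentiable_map h" and k: "differentiable_map k"
    and eq: "\<And>z. z \<in> topspace T \<Longrightarrow> k z = h (f z)"
    and v: "v \<in> tangent_space A x" and x: "x \<in> topspace T"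
  shows "differential A A h (f x) (differential A A f x v) = differential A A k x v"
proof -
  obtain c where c: "c \<in> A" "x \<in> cdom c"
    using chart_at x by blast
  obtain d where d: "d \<in> A" "f x \<in> cdom d"
    using chart_at differentiable_map_topspace[OF f x] by blast
  obtain e where e: "e \<in> A" "h (f x) \<in> cdom e"
    using chart_at differentiable_map_topspace[OF h differentiable_map_topspace[OF f x]] by blast
  have fv: "differential A A f x v \<in> tangent_space A (f x)"
    using differential_in_tangent_space f v x by blast
  have "differential A A h (f x) (differential A A f x v) e = differential A A k x v e"
    using differential_in_chart[OF h fv d e] differential_in_chart[OF f v c d]
      differential_in_chart[OF k v c] chart_chain_rule_eq[where f = f and h = h and k = k, OF f h eq c d e] eq[OF x] e
    by simp
  moreover have "differential A A h (f x) (differential A A f x v) \<in> tangent_space A (h (f x))"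
    using differential_in_tangent_space h fv differentiable_map_topspace[OF f x] by blast
  moreover have "differential A A k x v \<in> tangent_space A (h (f x))"
    using differential_in_tangent_space[OF k v x] eq[OF x] by simp
  ultimately show ?thesis
    using tangent_space_eqI[OF _ _ e] by simp
qed

lemma differential_id:
  assumes "v \<in> tangent_space A x" "x \<in> topspace T"
  shows "differential A A (\<lambda>z. z) x v = v"
proof -
  obtain c where c: "c \<in> A" "x \<in> cdom c"
    using chart_at assms by blast
  have "differential A A (\<lambda>z. z) x v c = v c"
    using differential_in_chart[OF differentiable_map_id assms(1) c c]
      tangent_spaceD[OF assms(1) c(1) c(1) c(2) c(2)] by simp
  then show ?thesis
    by (rule tangent_space_eqI[OF differential_in_tangent_space[OF differentiable_map_id assms]
          assms(1) c])
qed

lemma differential_add_scale: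
  assumes f: "differentiable_map f" and x: "x \<in> topspace T"
    and v: "v \<in> tangent_space A x" and w: "w \<in> tangent_space A x"
  shows "differential A A f x (r *\<^sub>R v + w) = r *\<^sub>R differential A A f x v + differential A A f x w"
proof -
  obtain c where c: "c \<in> A" "x \<in> cdom c"
    using chart_at x by blast
  obtain d where d: "d \<in> A" "f x \<in> cdom d"
    using chart_at differentiable_map_topspace[OF f x] by blast
  have vw: "r *\<^sub>R v + w \<in> tangent_space A x"
    using tangent_space_add_scale v w by blast
  have "linear (frechet_derivative (cmap d \<circ> f \<circ> cinv c) (at (cmap c x)))"
    using differentiable_mapD[OF f c(1) d(1) c(2) d(2)] by (rule linear_frechet_derivative)
  then have "differential A A f x (r *\<^sub>R v + w) d =
      (r *\<^sub>R differential A A f x v + differential A A f x w) d"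
    using differential_in_chart[OF f v c d] differential_in_chart[OF f w c d]
      differential_in_chart[OF f vw c d]
    by (simp add: linear_add linear_scale scaleR_fun_def)
  then show ?thesis
    by (intro tangent_space_eqI[OF _ _ d] tangent_space_add_scale
        differential_in_tangent_space[OF f _ x] vw v w)
qed

end

section \<open>Slices of smooth functions\<close>

text \<open>
  The set has to be open: the derivatives at its points see a full neighbourhood.
\<close>

lemma C_on_cong:
  assumes "open S" "\<And>x. x \<in> S \<Longrightarrow> f x = g x" "C_on k S f"
  shows "C_on k S g"
  using assms(2,3)
proof (induction k arbitrary: f g)
  case 0
  then show ?case
    using continuous_on_cong[of S S f g] by simp
next
  case (Suc k)
  have g': "(g has_derivative frechet_derivative f (at x)) (at x)" if "x \<in> S" for x
  proof (rule has_derivative_eq_on_open[OF assms(1) that Suc.prems(1)])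
    show "(f has_derivative frechet_derivative f (at x)) (at x)"
      using Suc.prems(2) that by (auto intro: frechet_has_derivative)
  qed
  then have "frechet_derivative g (at x) = frechet_derivative f (at x)" if "x \<in> S" for x
    using that frechet_derivative_at by metis
  then have "C_on k S (\<lambda>x. frechet_derivative g (at x) i)" if "i \<in> Basis" for i
    using Suc.IH[of "\<lambda>x. frechet_derivative f (at x) i" "\<lambda>x. frechet_derivative g (at x) i"]
      Suc.prems(2) that by simp
  moreover have "g differentiable (at x)" if "x \<in> S" for x
    using g'[OF that] differentiableI by blast
  ultimately show ?case by simp
qed

text \<open>
  The partial derivatives of the slice are those partial derivatives of \<open>f\<close> that belong to the basis
  vectors \<open>(i, 0)\<close>, so the claim reproduces itself under differentiation.
\<close>

lemma C_on_slice:
  fixes f :: "'e::euclidean_space \<times> 'f::euclidean_space \<Rightarrow> 'g::real_normed_vector"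
  assumes "open S'" "\<And>p. p \<in> S' \<Longrightarrow> (p, q) \<in> S" "C_on k S f"
  shows "C_on k S' (\<lambda>p. f (p, q))"
  using assms(3)
proof (induction k arbitrary: f)
  case 0
  have "continuous_on S' (f \<circ> (\<lambda>p. (p, q)))"
  proof (rule continuous_on_compose)
    show "continuous_on S' (\<lambda>p. (p, q))"
      by (intro continuous_intros)
    show "continuous_on ((\<lambda>p. (p, q)) ` S') f"
      using 0 assms(2) by (auto intro: continuous_on_subset)
  qed
  then show ?case by (simp add: comp_def)
next
  case (Suc k)
  have d: "((\<lambda>p. f (p, q)) has_derivative (\<lambda>v. frechet_derivative f (at (p, q)) (v, 0))) (at p)"
    if "p \<in> S'" for p
  proof -
    have "(f has_derivative frechet_derivative f (at (p, q))) (at (p, q))"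
      using Suc.prems assms(2)[OF that] by (auto intro: frechet_has_derivative)
    moreover have "((\<lambda>p. (p, q)) has_derivative (\<lambda>v. (v, 0))) (at p)"
      by (auto intro!: derivative_eq_intros)
    ultimately show ?thesis
      using diff_chain_at[of "\<lambda>p. (p, q)" "\<lambda>v. (v, 0)" p f] by (simp add: comp_def)
  qed
  have "C_on k S' (\<lambda>p. frechet_derivative (\<lambda>p. f (p, q)) (at p) i)" if i: "i \<in> Basis" for i
  proof (rule C_on_cong[OF assms(1)])
    have "(i, 0) \<in> (Basis :: ('e \<times> 'f) set)"
      using i unfolding Basis_prod_def by simp
    then show "C_on k S' (\<lambda>p. frechet_derivative f (at (p, q)) (i, 0))"
      using Suc.IH[of "\<lambda>x. frechet_derivative f (at x) (i, 0)"] Suc.prems by simp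
    show "frechet_derivative f (at (p, q)) (i, 0) = frechet_derivative (\<lambda>p. f (p, q)) (at p) i"
      if "p \<in> S'" for p
      by (rule fun_cong[OF frechet_derivative_at[OF d[OF that]]])
  qed
  moreover have "(\<lambda>p. f (p, q)) differentiable (at p)" if "p \<in> S'" for p
    using d[OF that] differentiableI by blast
  ultimately show ?case by simp
qed

section \<open>Left invariant fields\<close>

text \<open>
  Below the source is a space of vector fields, finite-dimensional inside an infinite-dimensional type
  of functions, and the target is the model space.
\<close>

lemma dim_image_inj_on:
  fixes f :: "'v::real_vector \<Rightarrow> 'w::real_vector"
  assumes "linear f" "inj_on f (span S)"
  shows "dim (f ` S) = dim S"
proof -
  obtain B where B: "B \<subseteq> S" "independent B" "S \<subseteq> span B" "card B = dim S"
    using basis_exists by blast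
  have sB: "span B = span S"
    using B(1,3) by (metis span_eq span_superset subset_trans)
  have "independent (f ` B)"
    using linear_independent_injective_image[OF assms(1) B(2)] assms(2) sB by simp
  moreover have "span (f ` B) = span (f ` S)"
    using assms(1) sB by (metis linear_span_image)
  ultimately have "dim (f ` S) = card (f ` B)"
    by (metis dim_eq_card)
  also have "\<dots> = card B"
    using card_image inj_on_subset[OF assms(2)] sB span_superset by metis
  finally show ?thesis
    using B(4) by simp
qed

context lie_group
begin

text \<open>
  The multiplication in the charts \<open>c1\<close>, \<open>c2\<close> of the factors and \<open>d\<close> of the product. The inverse of the
  product chart is not split into factors, so that smoothness of the multiplication applies literally.
\<close>

definition mult_rep ::
    "('a, 'e) chart \<Rightarrow> ('a, 'e) chart \<Rightarrow> ('a, 'e) chart \<Rightarrow> 'e \<times> 'e \<Rightarrow> 'e" where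
  "mult_rep c1 c2 d = cmap d \<circ> (\<lambda>(x, y). x \<otimes> y) \<circ>
     inv_into (cdom c1 \<times> cdom c2) (map_prod (cmap c1) (cmap c2))"

definition mult_dom ::
    "('a, 'e) chart \<Rightarrow> ('a, 'e) chart \<Rightarrow> ('a, 'e) chart \<Rightarrow> ('e \<times> 'e) set" where
  "mult_dom c1 c2 d = {(cmap c1 x, cmap c2 y) | x y. x \<in> cdom c1 \<and> y \<in> cdom c2 \<and> x \<otimes> y \<in> cdom d}"

lemma mult_rep_apply:
  assumes "c1 \<in> A" "c2 \<in> A" "x \<in> cdom c1" "y \<in> cdom c2"
  shows "mult_rep c1 c2 d (cmap c1 x, cmap c2 y) = cmap d (x \<otimes> y)"
proof -
  have "inj_on (map_prod (cmap c1) (cmap c2)) (cdom c1 \<times> cdom c2)"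
    using assms inj_cmap by (auto intro!: map_prod_inj_on)
  then have "inv_into (cdom c1 \<times> cdom c2) (map_prod (cmap c1) (cmap c2))
      (map_prod (cmap c1) (cmap c2) (x, y)) = (x, y)"
    using assms by (intro inv_into_f_f) auto
  then show ?thesis
    unfolding mult_rep_def by simp
qed

lemma smooth_on_mult_rep:
  assumes "c1 \<in> A" "c2 \<in> A" "d \<in> A"
  shows "smooth_on (mult_dom c1 c2 d) (mult_rep c1 c2 d)"
proof -
  let ?c = "(cdom c1 \<times> cdom c2, map_prod (cmap c1) (cmap c2))"
  have "?c \<in> prod_atlas A A"
    using assms unfolding prod_atlas_def by blast
  then have "smooth_on (cmap ?c ` {z \<in> cdom ?c. (\<lambda>(x, y). x \<otimes> y) z \<in> cdom d})
      (cmap d \<circ> (\<lambda>(x, y). x \<otimes> y) \<circ> cinv ?c)"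
    using smooth_mult assms(3) unfolding smooth_map_def by blast
  moreover have "cmap ?c ` {z \<in> cdom ?c. (\<lambda>(x, y). x \<otimes> y) z \<in> cdom d} = mult_dom c1 c2 d"
    unfolding mult_dom_def by force
  ultimately show ?thesis
    unfolding mult_rep_def by simp
qed

text \<open>
  In charts a left translation is a partial map of the multiplication, so its differential is a partial
  derivative of a smooth function of both factors. This gives the differentiability in the translated
  point and, below, the smooth dependence on the translating element.
\<close>

lemma left_translation_has_derivative:
  assumes c: "c1 \<in> A" "c2 \<in> A" "d \<in> A" and x: "x \<in> cdom c1" "y \<in> cdom c2" "x \<otimes> y \<in> cdom d"
  shows "((cmap d \<circ> (\<lambda>z. x \<otimes> z) \<circ> cinv c2) has_derivative
    (\<lambda>v. frechet_derivative (mult_rep c1 c2 d) (at (cmap c1 x, cmap c2 y)) (0, v))) (at (cmap c2 y))"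
proof (rule has_derivative_eq_on_open)
  have "(cmap c1 x, cmap c2 y) \<in> mult_dom c1 c2 d"
    using x unfolding mult_dom_def by blast
  then have "(mult_rep c1 c2 d has_derivative
      frechet_derivative (mult_rep c1 c2 d) (at (cmap c1 x, cmap c2 y))) (at (cmap c1 x, cmap c2 y))"
    using smooth_on_imp_differentiable[OF smooth_on_mult_rep[OF c]] frechet_has_derivative by blast
  moreover have "((\<lambda>q. (cmap c1 x, q)) has_derivative (\<lambda>v. (0, v))) (at (cmap c2 y))"
    by (auto intro!: derivative_eq_intros)
  ultimately show "((\<lambda>q. mult_rep c1 c2 d (cmap c1 x, q)) has_derivative
      (\<lambda>v. frechet_derivative (mult_rep c1 c2 d) (at (cmap c1 x, cmap c2 y)) (0, v))) (at (cmap c2 y))"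
    using diff_chain_at[of "\<lambda>q. (cmap c1 x, q)" "\<lambda>v. (0, v)" "cmap c2 y" "mult_rep c1 c2 d"]
    by (simp add: comp_def)
  show "open (cran c2)" "cmap c2 y \<in> cran c2"
    using open_cran c x by auto
  show "mult_rep c1 c2 d (cmap c1 x, q) = (cmap d \<circ> (\<lambda>z. x \<otimes> z) \<circ> cinv c2) q" if q: "q \<in> cran c2" for q
  proof -
    obtain z where "z \<in> cdom c2" "q = cmap c2 z"
      using q by blast
    then show ?thesis
      using mult_rep_apply[OF c(1,2) x(1)] c(2) by simp
  qed
qed

lemma differentiable_map_left_translation:
  assumes a: "a \<in> carrier G"
  shows "differentiable_map (\<lambda>z. a \<otimes> z)"
proof -
  have "continuous_map T (prod_topology T T) (\<lambda>z. (a, z))"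
    using a topspace_eq by (intro continuous_map_pairedI) auto
  moreover have "continuous_map (prod_topology T T) T (\<lambda>(x, y). x \<otimes> y)"
    using smooth_mult unfolding smooth_map_def by blast
  ultimately have "continuous_map T T ((\<lambda>(x, y). x \<otimes> y) \<circ> (\<lambda>z. (a, z)))"
    by (rule continuous_map_compose)
  moreover have "(cmap d \<circ> (\<lambda>z. a \<otimes> z) \<circ> cinv c) differentiable (at (cmap c x))"
    if "c \<in> A" "d \<in> A" "x \<in> cdom c" "a \<otimes> x \<in> cdom d" for c d x
  proof -
    obtain c1 where "c1 \<in> A" "a \<in> cdom c1"
      using chart_at a topspace_eq by blast
    then show ?thesis
      using left_translation_has_derivative that differentiableI by blast
  qed
  ultimately show ?thesis
    unfolding differentiable_map_def by (simp add: comp_def)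
qed

lemma differential_left_translation_mult:
  assumes "a \<in> carrier G" "x \<in> carrier G" "y \<in> carrier G" "v \<in> tangent_space A y"
  shows "differential A A (\<lambda>z. a \<otimes> z) (x \<otimes> y) (differential A A (\<lambda>z. x \<otimes> z) y v) =
    differential A A (\<lambda>z. a \<otimes> x \<otimes> z) y v"
  using differential_compose[of "\<lambda>z. x \<otimes> z" "\<lambda>z. a \<otimes> z" "\<lambda>z. a \<otimes> x \<otimes> z" v y] assms
    differentiable_map_left_translation topspace_eq m_assoc by simp

lemma differential_left_translation_in:
  assumes "a \<in> carrier G" "x \<in> carrier G" "v \<in> tangent_space A x"
  shows "differential A A (\<lambda>z. a \<otimes> z) x v \<in> tangent_space A (a \<otimes> x)"
  using differential_in_tangent_space[OF differentiable_map_left_translation] assms topspace_eq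
  by simp

text \<open>
  Left invariant fields without the smoothness requirement. Every tangent vector at the identity
  extends to such a field by translation, and these fields form a subspace for algebraic reasons.
  Smoothness is shown for a basis of them, which fixes the dimension of the Lie algebra.
\<close>

definition equivariant_fields :: "('a \<Rightarrow> ('a, 'e) tangent) set" where
  "equivariant_fields = {X. (\<forall>x\<in>carrier G. X x \<in> tangent_space A x) \<and>
     (\<forall>x. x \<notin> carrier G \<longrightarrow> X x = 0) \<and>
     (\<forall>a\<in>carrier G. \<forall>x\<in>carrier G. differential A A (\<lambda>z. a \<otimes> z) x (X x) = X (a \<otimes> x))}"

lemma lie_algebra_equivariant: "lie_algebra G A \<subseteq> equivariant_fields"
  unfolding lie_algebra_def left_invariant_field_def vector_field_def equivariant_fields_def
  using cover topspace_eq by auto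

lemma equivariant_tangent: "X \<in> equivariant_fields \<Longrightarrow> x \<in> carrier G \<Longrightarrow> X x \<in> tangent_space A x"
  unfolding equivariant_fields_def by blast

lemma equivariant_translate:
  "X \<in> equivariant_fields \<Longrightarrow> a \<in> carrier G \<Longrightarrow> x \<in> carrier G \<Longrightarrow>
     differential A A (\<lambda>z. a \<otimes> z) x (X x) = X (a \<otimes> x)"
  unfolding equivariant_fields_def by blast

lemma equivariant_from_one:
  assumes "X \<in> equivariant_fields" "x \<in> carrier G"
  shows "X x = differential A A (\<lambda>z. x \<otimes> z) \<one> (X \<one>)"
  using equivariant_translate[OF assms one_closed] assms(2) by simp

lemma equivariant_eqI:
  assumes X: "X \<in> equivariant_fields" and Y: "Y \<in> equivariant_fields" and eq: "X \<one> = Y \<one>"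
  shows "X = Y"
proof
  fix x
  show "X x = Y x"
  proof (cases "x \<in> carrier G")
    case True
    then show ?thesis
      using equivariant_from_one[OF X True] equivariant_from_one[OF Y True] eq by simp
  next
    case False
    then show ?thesis
      using X Y unfolding equivariant_fields_def by simp
  qed
qed

lemma equivariant_add_scale:
  assumes X: "X \<in> equivariant_fields" and Y: "Y \<in> equivariant_fields"
  shows "r *\<^sub>R X + Y \<in> equivariant_fields"
proof -
  have eval: "(r *\<^sub>R X + Y) x = r *\<^sub>R X x + Y x" for x
    by (simp add: scaleR_fun_def)
  show ?thesis
    unfolding equivariant_fields_def mem_Collect_eq eval
  proof (intro conjI ballI allI impI)
    fix x assume "x \<in> carrier G"
    then show "r *\<^sub>R X x + Y x \<in> tangent_space A x"
      using tangent_space_add_scale equivariant_tangent X Y by blast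
  next
    fix x assume "x \<notin> carrier G"
    then show "r *\<^sub>R X x + Y x = 0"
      using X Y unfolding equivariant_fields_def by simp
  next
    fix a x assume a: "a \<in> carrier G" and x: "x \<in> carrier G"
    have "x \<in> topspace T"
      using x topspace_eq by simp
    then show "differential A A (\<lambda>z. a \<otimes> z) x (r *\<^sub>R X x + Y x) = r *\<^sub>R X (a \<otimes> x) + Y (a \<otimes> x)"
      using differential_add_scale[OF differentiable_map_left_translation[OF a] _
          equivariant_tangent[OF X x] equivariant_tangent[OF Y x]]
        equivariant_translate[OF X a x] equivariant_translate[OF Y a x] by simp
  qed
qed

lemma subspace_equivariant: "subspace equivariant_fields"
proof -
  have 0: "0 \<in> equivariant_fields"
  proof -
    have "differential A A (\<lambda>z. a \<otimes> z) x 0 = 0" if "a \<in> carrier G" "x \<in> carrier G" for a x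
      using differential_add_scale[OF differentiable_map_left_translation[OF that(1)] _
          zero_in_tangent_space zero_in_tangent_space, of x 1] that(2) topspace_eq by simp
    then show ?thesis
      unfolding equivariant_fields_def by (simp add: zero_in_tangent_space)
  qed
  show ?thesis
  proof (rule subspaceI)
    show "0 \<in> equivariant_fields" by (rule 0)
  next
    fix X Y assume "X \<in> equivariant_fields" "Y \<in> equivariant_fields"
    from equivariant_add_scale[OF this, of 1] show "X + Y \<in> equivariant_fields"
      by simp
  next
    fix r :: real and X assume "X \<in> equivariant_fields"
    from equivariant_add_scale[OF this 0, of r] show "r *\<^sub>R X \<in> equivariant_fields"
      by simp
  qed
qed

definition extend_from_one :: "('a, 'e) tangent \<Rightarrow> 'a \<Rightarrow> ('a, 'e) tangent" where
  "extend_from_one w = (\<lambda>x. if x \<in> carrier G then differential A A (\<lambda>z. x \<otimes> z) \<one> w else 0)"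

lemma extend_equivariant:
  assumes "w \<in> tangent_space A \<one>"
  shows "extend_from_one w \<in> equivariant_fields"
  using assms differential_left_translation_in[of _ \<one> w]
    differential_left_translation_mult[of _ _ \<one> w]
  unfolding equivariant_fields_def extend_from_one_def by auto

text \<open>
  Translate the vector to the identity and spread it over the group from there.
\<close>

lemma equivariant_through_vector:
  assumes x: "x \<in> carrier G" and w: "w \<in> tangent_space A x"
  obtains X where "X \<in> equivariant_fields" "X x = w"
proof
  define v where "v = differential A A (\<lambda>z. inv x \<otimes> z) x w"
  have v: "v \<in> tangent_space A \<one>"
    using differential_left_translation_in[of "inv x" x w] x w unfolding v_def by simp
  then show "extend_from_one v \<in> equivariant_fields"
    by (rule extend_equivariant)
  have "differential A A (\<lambda>z. x \<otimes> z) (inv x \<otimes> x) v = differential A A (\<lambda>z. z) x w"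
    unfolding v_def
  proof (rule differential_compose)
    show "z = x \<otimes> (inv x \<otimes> z)" if "z \<in> topspace T" for z
      using that x topspace_eq by (simp add: inv_solve_left m_assoc[symmetric])
  qed (use x w topspace_eq differentiable_map_left_translation differentiable_map_id in auto)
  then show "extend_from_one v x = w"
    using differential_id[OF w] x topspace_eq unfolding extend_from_one_def by simp
qed

text \<open>
  Near any point, the coordinates of the field spread from \<open>i\<close> at the identity are the partial derivative
  of the multiplication in the direction \<open>(0, i)\<close>, restricted to the slice where the second factor is the
  identity. For a basis vector \<open>i\<close> this is one of the partial derivatives of a smooth map.
\<close>

lemma extend_basis_in_lie_algebra:
  assumes c0: "c0 \<in> A" "\<one> \<in> cdom c0" and i: "i \<in> Basis"
  shows "extend_from_one (coord_vec A c0 \<one> i) \<in> lie_algebra G A"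
proof -
  let ?w = "coord_vec A c0 \<one> i"
  have w: "?w \<in> tangent_space A \<one>" "?w c0 = i"
    using coord_vec_in_tangent_space coord_vec_chart c0 by auto
  have E: "extend_from_one ?w \<in> equivariant_fields"
    using w(1) by (rule extend_equivariant)
  have "smooth_on (cran c) (\<lambda>p. extend_from_one ?w (cinv c p) c)" if c: "c \<in> A" for c
    unfolding smooth_on_def
  proof
    fix k
    let ?D = "\<lambda>z. frechet_derivative (mult_rep c c0 c) (at z) (0, i)"
    have "(0, i) \<in> Basis"
      using i unfolding Basis_prod_def by simp
    moreover have "C_on (Suc k) (mult_dom c c0 c) (mult_rep c c0 c)"
      using smooth_on_mult_rep[OF c c0(1) c] unfolding smooth_on_def by blast
    ultimately have D: "C_on k (mult_dom c c0 c) ?D"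
      unfolding C_on.simps by blast
    have in_carrier: "x \<in> carrier G" if "x \<in> cdom c" for x
      using cdom_subset c that topspace_eq by blast
    show "C_on k (cran c) (\<lambda>p. extend_from_one ?w (cinv c p) c)"
    proof (rule C_on_cong[OF open_cran[OF c]])
      show "C_on k (cran c) (\<lambda>p. ?D (p, cmap c0 \<one>))"
      proof (rule C_on_slice[OF open_cran[OF c] _ D])
        show "(p, cmap c0 \<one>) \<in> mult_dom c c0 c" if "p \<in> cran c" for p
          using that c0 in_carrier unfolding mult_dom_def by force
      qed
      show "?D (p, cmap c0 \<one>) = extend_from_one ?w (cinv c p) c" if p: "p \<in> cran c" for p
      proof -
        obtain x where x: "x \<in> cdom c" "p = cmap c x"
          using p by blast
        have xG: "x \<in> carrier G"
          using in_carrier x by blast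
        have "((cmap c \<circ> (\<lambda>z. x \<otimes> z) \<circ> cinv c0) has_derivative
          (\<lambda>v. frechet_derivative (mult_rep c c0 c) (at (cmap c x, cmap c0 \<one>)) (0, v))) (at (cmap c0 \<one>))"
          using left_translation_has_derivative[OF c c0(1) c x(1) c0(2)] x xG by simp
        from fun_cong[OF frechet_derivative_at[OF this], of i] show ?thesis
          using differential_in_chart[OF differentiable_map_left_translation[OF xG] w(1) c0 c]
            x xG w(2) c unfolding extend_from_one_def by simp
      qed
    qed
  qed
  then show ?thesis
    using E cover topspace_eq
    unfolding lie_algebra_def left_invariant_field_def vector_field_def equivariant_fields_def
    by auto
qed

lemma linear_eval: "linear (\<lambda>X :: 'a \<Rightarrow> ('a, 'e) tangent. X x c)"
  by (rule linearI) (simp_all add: scaleR_fun_def)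

lemma inj_on_eval:
  assumes "c0 \<in> A" "\<one> \<in> cdom c0"
  shows "inj_on (\<lambda>X. X \<one> c0) equivariant_fields"
proof (rule inj_onI)
  fix X Y assume X: "X \<in> equivariant_fields" and Y: "Y \<in> equivariant_fields" and "X \<one> c0 = Y \<one> c0"
  then have "X \<one> = Y \<one>"
    using tangent_space_eqI[OF equivariant_tangent[OF X one_closed] equivariant_tangent[OF Y one_closed] assms]
    by simp
  then show "X = Y"
    using equivariant_eqI X Y by blast
qed

text \<open>
  Evaluation at the identity is injective on equivariant fields, and the image of the Lie algebra
  contains the standard basis.
\<close>

lemma dim_lie_algebra: "dim (lie_algebra G A) = DIM('e)"
proof -
  obtain c0 where c0: "c0 \<in> A" "\<one> \<in> cdom c0"
    using chart_at topspace_eq by blast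
  let ?ev = "\<lambda>X :: 'a \<Rightarrow> ('a, 'e) tangent. X \<one> c0"
  have "Basis \<subseteq> ?ev ` lie_algebra G A"
  proof
    fix i :: 'e assume i: "i \<in> Basis"
    let ?X = "extend_from_one (coord_vec A c0 \<one> i)"
    have w: "coord_vec A c0 \<one> i \<in> tangent_space A \<one>"
      using coord_vec_in_tangent_space c0 by blast
    have X: "?X \<in> lie_algebra G A"
      using extend_basis_in_lie_algebra c0 i by blast
    have "differential A A (\<lambda>z. \<one> \<otimes> z) \<one> (coord_vec A c0 \<one> i) =
        differential A A (\<lambda>z. z) \<one> (coord_vec A c0 \<one> i)"
      using differential_compose[of "\<lambda>z. z" "\<lambda>z. z" "\<lambda>z. \<one> \<otimes> z" "coord_vec A c0 \<one> i" \<one>]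
        differential_id[OF w] differentiable_map_left_translation differentiable_map_id w topspace_eq
      by simp
    then have "?ev ?X = i"
      using differential_id[OF w] coord_vec_chart[OF c0] topspace_eq
      unfolding extend_from_one_def by simp
    then show "i \<in> ?ev ` lie_algebra G A"
      using X by (metis (mono_tags, lifting) image_eqI)
  qed
  then have "span (?ev ` lie_algebra G A) = UNIV"
    by (metis span_Basis span_mono top.extremum_uniqueI)
  then have "dim (?ev ` lie_algebra G A) = DIM('e)"
    by (metis dim_UNIV dim_span)
  moreover have "inj_on ?ev (span (lie_algebra G A))"
    using inj_on_eval[OF c0] span_minimal[OF lie_algebra_equivariant subspace_equivariant]
    by (rule inj_on_subset)
  ultimately show ?thesis
    using dim_image_inj_on[OF linear_eval] by metis
qed

text \<open>
  Evaluated at the identity, \<open>U\<close> is a hyperplane by the dimension count, and \<open>b\<close> lies outside of it.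
  Injectivity of the evaluation lifts the decomposition of vectors to fields.
\<close>

lemma equivariant_decomposition:
  assumes b: "b \<in> lie_algebra G A" "b \<notin> U" and U: "subspace U" "U \<subseteq> lie_algebra G A"
    and codim: "codim_one G A U" and X: "X \<in> equivariant_fields"
  obtains r z where "z \<in> U" "X = r *\<^sub>R b + z"
proof -
  obtain c0 where c0: "c0 \<in> A" "\<one> \<in> cdom c0"
    using chart_at topspace_eq by blast
  let ?ev = "\<lambda>X :: 'a \<Rightarrow> ('a, 'e) tangent. X \<one> c0"
  have UE: "U \<subseteq> equivariant_fields" and bE: "b \<in> equivariant_fields"
    using U b lie_algebra_equivariant by blast+
  have sub: "subspace (?ev ` U)"
    using linear_subspace_image[OF linear_eval U(1)] .
  have span_subspace_eq: "span (?ev ` U) = ?ev ` U"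
    using span_eq_iff sub by blast
  have "span U = U"
    using U(1) by simp
  then have "dim (?ev ` U) = dim U"
    using dim_image_inj_on[OF linear_eval, where S = U] inj_on_subset[OF inj_on_eval[OF c0] UE] by metis
  moreover have "?ev b \<notin> ?ev ` U"
  proof
    assume "?ev b \<in> ?ev ` U"
    then obtain z where "z \<in> U" "?ev b = ?ev z"
      by blast
    then show False
      using inj_onD[OF inj_on_eval[OF c0], of b z] bE UE b(2) by blast
  qed
  ultimately have "dim (insert (?ev b) (?ev ` U)) = DIM('e)"
    using codim dim_lie_algebra
    unfolding codim_one_def by (simp add: dim_insert span_subspace_eq)
  then have "?ev X \<in> span (insert (?ev b) (?ev ` U))"
    by (metis UNIV_I dim_eq_full)
  then obtain r where "?ev X - r *\<^sub>R ?ev b \<in> ?ev ` U"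
    using span_breakdown_eq sub by (metis span_eq_iff)
  then obtain z where z: "z \<in> U" "?ev X - r *\<^sub>R ?ev b = ?ev z"
    by blast
  then have "?ev X = ?ev (r *\<^sub>R b + z)"
    by (simp add: scaleR_fun_def algebra_simps)
  moreover have "r *\<^sub>R b + z \<in> equivariant_fields"
    using equivariant_add_scale bE UE z(1) by blast
  ultimately have "X = r *\<^sub>R b + z"
    using inj_onD[OF inj_on_eval[OF c0]] X by blast
  then show ?thesis
    using that z(1) by blast
qed

end

section \<open>The spray of a Randers metric in a chart\<close>

lemma inner_matrix_symmetric:
  fixes M :: "real ^ 'n ^ 'n"
  assumes "transpose M = M"
  shows "x \<bullet> (M *v y) = y \<bullet> (M *v x)"
  by (metis assms dot_lmul_matrix inner_commute transpose_matrix_vector)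

lemma inner_axis_one: "(v :: real ^ 'n) \<bullet> axis i 1 = v $ i"
  by (simp add: inner_axis)

lemma linear_sum_axis:
  fixes \<phi> :: "real ^ 'n \<Rightarrow> real"
  assumes "linear \<phi>"
  shows "(\<Sum>m\<in>UNIV. \<phi> (axis m 1) * y $ m) = \<phi> y"
proof -
  have "\<phi> y = \<phi> (\<Sum>m\<in>UNIV. y $ m *\<^sub>R axis m 1)"
    using basis_expansion[of y] by (simp add: scalar_mult_eq_scaleR)
  also have "\<dots> = (\<Sum>m\<in>UNIV. y $ m *\<^sub>R \<phi> (axis m 1))"
    using assms by (simp add: linear_sum linear_scale)
  finally show ?thesis
    by (simp add: mult.commute)
qed

text \<open>
  Positivity makes the kernel trivial, so that \<open>matrix_inv\<close> is a genuine two-sided inverse.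
\<close>

lemma matrix_inv_mult_vec:
  fixes M :: "real ^ 'n ^ 'n"
  assumes "\<And>w. w \<noteq> 0 \<Longrightarrow> w \<bullet> (M *v w) > 0"
  shows "matrix_inv M *v (M *v w) = w" "M *v (matrix_inv M *v w) = w"
proof -
  have "w = 0" if "M *v w = 0" for w
    using assms[of w] that by auto
  then have "invertible M"
    unfolding invertible_left_inverse matrix_left_invertible_ker by blast
  then have "M ** matrix_inv M = mat 1 \<and> matrix_inv M ** M = mat 1"
    unfolding invertible_def matrix_inv_def by (rule someI_ex)
  then show "matrix_inv M *v (M *v w) = w" "M *v (matrix_inv M *v w) = w"
    by (simp_all add: matrix_vector_mul_assoc)
qed

lemma matrix_vector_mult_neg: "(M :: real ^ 'n ^ 'm) *v (- v) = - (M *v v)"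
  by (rule linear_neg) (rule matrix_vector_mul_linear)

lemma partial_eqI:
  assumes "open S" "p \<in> S" "\<And>q. q \<in> S \<Longrightarrow> h q = f q"
    and "((\<lambda>t. h (p + t *\<^sub>R axis i 1)) has_real_derivative D) (at 0)"
  shows "partial i f p = D"
proof -
  have "open ((\<lambda>t. p + t *\<^sub>R axis i 1) -` S)"
    using assms(1) by (intro open_vimage continuous_intros)
  then have "((\<lambda>t. f (p + t *\<^sub>R axis i 1)) has_real_derivative D) (at 0)"
    by (rule has_field_derivative_transform_within_open[OF assms(4)]) (use assms in auto)
  then show ?thesis
    unfolding partial_def by (rule DERIV_imp_deriv)
qed

lemma DERIV_sqrt_comp:
  assumes "(f has_real_derivative D) (at t)" "f t > 0"
  shows "((\<lambda>t. sqrt (f t)) has_real_derivative D / (2 * sqrt (f t))) (at t)"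
  using assms by (auto intro!: derivative_eq_intros simp: field_simps)

lemma DERIV_matrix_entry:
  fixes a :: "real ^ 'n \<Rightarrow> real ^ 'n ^ 'n"
  assumes "(a has_derivative a') (at p)"
  shows "((\<lambda>t. w \<bullet> (a (p + t *\<^sub>R v) *v y)) has_real_derivative w \<bullet> (a' v *v y)) (at 0)"
proof -
  have "linear (\<lambda>M :: real ^ 'n ^ 'n. w \<bullet> (M *v y))"
    by (rule linearI)
      (simp_all add: matrix_vector_mult_add_rdistrib inner_add_right flip: scaleR_matrix_vector_assoc)
  then have lin: "bounded_linear (\<lambda>M :: real ^ 'n ^ 'n. w \<bullet> (M *v y))"
    by (simp add: linear_conv_bounded_linear)
  have "((\<lambda>t. p + t *\<^sub>R v) has_derivative (\<lambda>t. t *\<^sub>R v)) (at 0)"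
    by (auto intro!: derivative_eq_intros)
  then have "(a \<circ> (\<lambda>t. p + t *\<^sub>R v) has_derivative a' \<circ> (\<lambda>t. t *\<^sub>R v)) (at 0)"
    by (rule diff_chain_at) (simp add: assms)
  then have "((\<lambda>t. a (p + t *\<^sub>R v)) has_derivative (\<lambda>t. a' (t *\<^sub>R v))) (at 0)"
    by (simp only: comp_def)
  then have "((\<lambda>t. w \<bullet> (a (p + t *\<^sub>R v) *v y)) has_derivative (\<lambda>t. w \<bullet> (a' (t *\<^sub>R v) *v y))) (at 0)"
    by (rule bounded_linear.has_derivative[OF lin])
  moreover have "w \<bullet> (a' (t *\<^sub>R v) *v y) = (w \<bullet> (a' v *v y)) * t" for t
    using has_derivative_linear[OF assms] by (simp add: linear_scale flip: scaleR_matrix_vector_assoc)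
  ultimately show ?thesis
    unfolding has_field_derivative_def by simp
qed

lemma DERIV_inner_direction:
  fixes \<beta> :: "real ^ 'n \<Rightarrow> real ^ 'n"
  assumes "(\<beta> has_derivative \<beta>') (at p)"
  shows "((\<lambda>t. \<beta> (p + t *\<^sub>R v) \<bullet> w) has_real_derivative \<beta>' v \<bullet> w) (at 0)"
proof -
  have "((\<lambda>t. p + t *\<^sub>R v) has_derivative (\<lambda>t. t *\<^sub>R v)) (at 0)"
    by (auto intro!: derivative_eq_intros)
  then have "(\<beta> \<circ> (\<lambda>t. p + t *\<^sub>R v) has_derivative \<beta>' \<circ> (\<lambda>t. t *\<^sub>R v)) (at 0)"
    by (rule diff_chain_at) (simp add: assms)
  then have "((\<lambda>t. \<beta> (p + t *\<^sub>R v)) has_derivative (\<lambda>t. \<beta>' (t *\<^sub>R v))) (at 0)"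
    by (simp only: comp_def)
  then have "((\<lambda>t. \<beta> (p + t *\<^sub>R v) \<bullet> w) has_derivative (\<lambda>t. \<beta>' (t *\<^sub>R v) \<bullet> w)) (at 0)"
    by (rule has_derivative_inner_left)
  moreover have "\<beta>' (t *\<^sub>R v) \<bullet> w = (\<beta>' v \<bullet> w) * t" for t
    using has_derivative_linear[OF assms] by (simp add: linear_scale)
  ultimately show ?thesis
    unfolding has_field_derivative_def by simp
qed

text \<open>
  In a chart, \<open>F\<close> is the function \<open>\<alpha> + \<beta>\<close> where \<open>\<alpha>\<close> is the norm of the Riemannian metric \<open>a\<close> and \<open>\<beta>\<close> is a
  one-form, represented by its vector of coefficients. First derivatives of \<open>a\<close> and \<open>\<beta>\<close> in the base
  point are all that enters the spray.
\<close>

locale local_randers =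
  fixes A :: "('a, real ^ 'n) chart set" and F :: "'a \<Rightarrow> ('a, real ^ 'n) tangent \<Rightarrow> real"
    and c :: "('a, real ^ 'n) chart" and S :: "(real ^ 'n) set"
    and a :: "real ^ 'n \<Rightarrow> real ^ 'n ^ 'n" and \<beta> :: "real ^ 'n \<Rightarrow> real ^ 'n"
  assumes open_S: "open S"
    and a_differentiable: "p \<in> S \<Longrightarrow> a differentiable (at p)"
    and beta_differentiable: "p \<in> S \<Longrightarrow> \<beta> differentiable (at p)"
    and a_symmetric: "p \<in> S \<Longrightarrow> transpose (a p) = a p"
    and a_positive: "p \<in> S \<Longrightarrow> y \<noteq> 0 \<Longrightarrow> y \<bullet> (a p *v y) > 0"
    and local_rep_randers: "p \<in> S \<Longrightarrow> local_rep A F c p y = sqrt (y \<bullet> (a p *v y)) + \<beta> p \<bullet> y"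
    and tensor_positive: "p \<in> S \<Longrightarrow> y \<noteq> 0 \<Longrightarrow> w \<noteq> 0 \<Longrightarrow>
      w \<bullet> (fundamental_tensor A F c p y *v w) > 0"
begin

definition \<alpha> :: "real ^ 'n \<Rightarrow> real ^ 'n \<Rightarrow> real" where
  "\<alpha> p y = sqrt (y \<bullet> (a p *v y))"

definition R :: "real ^ 'n \<Rightarrow> real ^ 'n \<Rightarrow> real" where
  "R p y = \<alpha> p y + \<beta> p \<bullet> y"

definition grad_\<alpha> :: "real ^ 'n \<Rightarrow> real ^ 'n \<Rightarrow> real ^ 'n" where
  "grad_\<alpha> p y = (1 / \<alpha> p y) *\<^sub>R (a p *v y)"

definition grad_R :: "real ^ 'n \<Rightarrow> real ^ 'n \<Rightarrow> real ^ 'n" where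
  "grad_R p y = grad_\<alpha> p y + \<beta> p"

definition Da :: "real ^ 'n \<Rightarrow> real ^ 'n \<Rightarrow> real ^ 'n ^ 'n" where
  "Da p = frechet_derivative a (at p)"

definition D\<beta> :: "real ^ 'n \<Rightarrow> real ^ 'n \<Rightarrow> real ^ 'n" where
  "D\<beta> p = frechet_derivative \<beta> (at p)"

text \<open>
  A suffix \<open>_x\<close> marks the derivative in the base point \<open>p\<close> in direction \<open>v\<close>, with the tangent vector \<open>y\<close>
  held fixed; \<open>grad\<close> refers to derivatives in \<open>y\<close>.
\<close>

definition \<alpha>_x :: "real ^ 'n \<Rightarrow> real ^ 'n \<Rightarrow> real ^ 'n \<Rightarrow> real" where
  "\<alpha>_x p y v = y \<bullet> (Da p v *v y) / (2 * \<alpha> p y)"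

definition R_x :: "real ^ 'n \<Rightarrow> real ^ 'n \<Rightarrow> real ^ 'n \<Rightarrow> real" where
  "R_x p y v = \<alpha>_x p y v + D\<beta> p v \<bullet> y"

definition grad_R_x :: "real ^ 'n \<Rightarrow> real ^ 'n \<Rightarrow> real ^ 'n \<Rightarrow> real ^ 'n \<Rightarrow> real" where
  "grad_R_x p y v w =
     (w \<bullet> (Da p v *v y) - (grad_\<alpha> p y \<bullet> w) * \<alpha>_x p y v) / \<alpha> p y + D\<beta> p v \<bullet> w"

lemma a_has_derivative: "p \<in> S \<Longrightarrow> (a has_derivative Da p) (at p)"
  unfolding Da_def using a_differentiable frechet_derivative_works by blast

lemma beta_has_derivative: "p \<in> S \<Longrightarrow> (\<beta> has_derivative D\<beta> p) (at p)"
  unfolding D\<beta>_def using beta_differentiable frechet_derivative_works by blast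

lemma linear_Da: "p \<in> S \<Longrightarrow> linear (Da p)"
  using a_has_derivative has_derivative_linear by blast

lemma linear_D\<beta>: "p \<in> S \<Longrightarrow> linear (D\<beta> p)"
  using beta_has_derivative has_derivative_linear by blast

lemma local_rep_R: "p \<in> S \<Longrightarrow> local_rep A F c p y = R p y"
  using local_rep_randers unfolding R_def \<alpha>_def by simp

lemma alpha_pos: "p \<in> S \<Longrightarrow> y \<noteq> 0 \<Longrightarrow> \<alpha> p y > 0"
  unfolding \<alpha>_def using a_positive by simp

lemma alpha_square: "p \<in> S \<Longrightarrow> y \<noteq> 0 \<Longrightarrow> y \<bullet> (a p *v y) = \<alpha> p y * \<alpha> p y"
  unfolding \<alpha>_def using a_positive[of p y] by simp

lemma DERIV_alpha:
  assumes "p \<in> S" "y \<noteq> 0"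
  shows "((\<lambda>t. \<alpha> p (y + t *\<^sub>R v)) has_real_derivative grad_\<alpha> p y \<bullet> v) (at 0)"
proof -
  have "(y + t *\<^sub>R v) \<bullet> (a p *v (y + t *\<^sub>R v)) =
      y \<bullet> (a p *v y) + t * (2 * (v \<bullet> (a p *v y))) + t * t * (v \<bullet> (a p *v v))" for t
    using inner_matrix_symmetric[OF a_symmetric[OF assms(1)], of y v]
    by (simp add: matrix_vector_right_distrib matrix_vector_mult_scaleR inner_add_left
        inner_add_right algebra_simps)
  moreover have "((\<lambda>t. y \<bullet> (a p *v y) + t * (2 * (v \<bullet> (a p *v y))) + t * t * (v \<bullet> (a p *v v)))
      has_real_derivative 2 * (v \<bullet> (a p *v y))) (at 0)"
    by (auto intro!: derivative_eq_intros)
  ultimately have "((\<lambda>t. (y + t *\<^sub>R v) \<bullet> (a p *v (y + t *\<^sub>R v)))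
      has_real_derivative 2 * (v \<bullet> (a p *v y))) (at 0)"
    by simp
  from DERIV_sqrt_comp[OF this] show ?thesis
    using a_positive[OF assms] unfolding \<alpha>_def grad_\<alpha>_def
    by (simp add: inner_commute)
qed

lemma DERIV_R:
  assumes "p \<in> S" "y \<noteq> 0"
  shows "((\<lambda>t. R p (y + t *\<^sub>R v)) has_real_derivative grad_R p y \<bullet> v) (at 0)"
proof -
  have "((\<lambda>t. \<beta> p \<bullet> (y + t *\<^sub>R v)) has_real_derivative \<beta> p \<bullet> v) (at 0)"
    by (auto simp: inner_add_right intro!: derivative_eq_intros)
  from DERIV_add[OF DERIV_alpha[OF assms] this] show ?thesis
    unfolding R_def grad_R_def by (simp add: inner_add_left)
qed

lemma DERIV_grad_R:
  assumes "p \<in> S" "y \<noteq> 0"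
  shows "((\<lambda>t. grad_R p (y + t *\<^sub>R v) \<bullet> w) has_real_derivative
     (v \<bullet> (a p *v w) - (grad_\<alpha> p y \<bullet> v) * (grad_\<alpha> p y \<bullet> w)) / \<alpha> p y) (at 0)"
proof -
  have "((\<lambda>t. w \<bullet> (a p *v y) + t * (w \<bullet> (a p *v v))) has_real_derivative w \<bullet> (a p *v v)) (at 0)"
    by (auto intro!: derivative_eq_intros)
  then have "((\<lambda>t. (w \<bullet> (a p *v y) + t * (w \<bullet> (a p *v v))) / \<alpha> p (y + t *\<^sub>R v) + \<beta> p \<bullet> w)
      has_real_derivative (v \<bullet> (a p *v w) - (grad_\<alpha> p y \<bullet> v) * (grad_\<alpha> p y \<bullet> w)) / \<alpha> p y) (at 0)"
    using DERIV_alpha[OF assms, of v] alpha_pos[OF assms]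
      inner_matrix_symmetric[OF a_symmetric[OF assms(1)], of w v]
    by (auto intro!: derivative_eq_intros simp: grad_\<alpha>_def inner_commute field_simps)
  moreover have "grad_R p (y + t *\<^sub>R v) \<bullet> w =
      (w \<bullet> (a p *v y) + t * (w \<bullet> (a p *v v))) / \<alpha> p (y + t *\<^sub>R v) + \<beta> p \<bullet> w" for t
    unfolding grad_R_def grad_\<alpha>_def
    by (simp add: matrix_vector_right_distrib matrix_vector_mult_scaleR inner_add_left
        inner_add_right inner_commute)
  ultimately show ?thesis by simp
qed

lemma DERIV_alpha_x:
  assumes "p \<in> S" "y \<noteq> 0"
  shows "((\<lambda>t. \<alpha> (p + t *\<^sub>R v) y) has_real_derivative \<alpha>_x p y v) (at 0)"
  using DERIV_sqrt_comp[OF DERIV_matrix_entry[OF a_has_derivative[OF assms(1)], of y v y]]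
    a_positive[OF assms]
  unfolding \<alpha>_def \<alpha>_x_def by simp

lemma DERIV_R_x:
  assumes "p \<in> S" "y \<noteq> 0"
  shows "((\<lambda>t. R (p + t *\<^sub>R v) y) has_real_derivative R_x p y v) (at 0)"
  using DERIV_add[OF DERIV_alpha_x[OF assms] DERIV_inner_direction[OF beta_has_derivative[OF assms(1)]]]
  unfolding R_def R_x_def by simp

lemma DERIV_grad_R_x:
  assumes "p \<in> S" "y \<noteq> 0"
  shows "((\<lambda>t. grad_R (p + t *\<^sub>R v) y \<bullet> w) has_real_derivative grad_R_x p y v w) (at 0)"
proof -
  have "((\<lambda>t. (w \<bullet> (a (p + t *\<^sub>R v) *v y)) / \<alpha> (p + t *\<^sub>R v) y + \<beta> (p + t *\<^sub>R v) \<bullet> w)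
      has_real_derivative grad_R_x p y v w) (at 0)"
    using DERIV_alpha_x[OF assms, of v] alpha_pos[OF assms]
      DERIV_matrix_entry[OF a_has_derivative[OF assms(1)], of w v y]
      DERIV_inner_direction[OF beta_has_derivative[OF assms(1)], of v w]
    by (auto intro!: derivative_eq_intros simp: grad_R_x_def grad_\<alpha>_def inner_commute field_simps)
  moreover have "grad_R q y \<bullet> w = (w \<bullet> (a q *v y)) / \<alpha> q y + \<beta> q \<bullet> w" for q
    unfolding grad_R_def grad_\<alpha>_def by (simp add: inner_add_left inner_add_right inner_commute)
  ultimately show ?thesis by simp
qed

lemma partial_y_square:
  assumes "p \<in> S" "y \<noteq> 0"
  shows "partial l (\<lambda>y'. (local_rep A F c p y')\<^sup>2) y = 2 * R p y * (grad_R p y \<bullet> axis l 1)"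
proof (rule partial_eqI[of "- {0}"])
  show "((\<lambda>t. (R p (y + t *\<^sub>R axis l 1))\<^sup>2) has_real_derivative
      2 * R p y * (grad_R p y \<bullet> axis l 1)) (at 0)"
    using DERIV_power[OF DERIV_R[OF assms], where n = 2] by (simp add: mult_ac)
qed (use assms local_rep_R in auto)

lemma fundamental_tensor_entry:
  assumes "p \<in> S" "y \<noteq> 0"
  shows "fundamental_tensor A F c p y $ i $ j = (grad_R p y $ i) * (grad_R p y $ j)
     + R p y / \<alpha> p y * (a p $ i $ j - (grad_\<alpha> p y $ i) * (grad_\<alpha> p y $ j))"
proof -
  have "partial i (partial j (\<lambda>y'. (local_rep A F c p y')\<^sup>2)) y =
      2 * ((grad_R p y \<bullet> axis i 1) * (grad_R p y \<bullet> axis j 1)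
        + R p y * ((axis i 1 \<bullet> (a p *v axis j 1)
          - (grad_\<alpha> p y \<bullet> axis i 1) * (grad_\<alpha> p y \<bullet> axis j 1)) / \<alpha> p y))"
  proof (rule partial_eqI[of "- {0}"])
    show "((\<lambda>t. 2 * R p (y + t *\<^sub>R axis i 1) * (grad_R p (y + t *\<^sub>R axis i 1) \<bullet> axis j 1))
      has_real_derivative 2 * ((grad_R p y \<bullet> axis i 1) * (grad_R p y \<bullet> axis j 1)
        + R p y * ((axis i 1 \<bullet> (a p *v axis j 1)
          - (grad_\<alpha> p y \<bullet> axis i 1) * (grad_\<alpha> p y \<bullet> axis j 1)) / \<alpha> p y))) (at 0)"
      using DERIV_cmult[OF DERIV_mult[OF DERIV_R[OF assms] DERIV_grad_R[OF assms]], of 2 "axis i 1" "axis i 1" "axis j 1"]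
      by (simp add: algebra_simps)
  qed (use assms partial_y_square in auto)
  moreover have "axis i 1 \<bullet> (a p *v axis j 1) = a p $ i $ j"
    by (simp add: inner_axis' matrix_vector_mul_component inner_axis)
  ultimately show ?thesis
    unfolding fundamental_tensor_def by (simp add: inner_axis_one)
qed

text \<open>
  The fundamental tensor is the dyad of the gradient of \<open>F\<close> plus \<open>F / \<alpha>\<close> times the metric \<open>a\<close> with the
  direction of \<open>y\<close> projected out. This closed form lets the spray be verified by applying the tensor,
  without ever inverting it explicitly.
\<close>

lemma fundamental_tensor_mult_vec:
  assumes "p \<in> S" "y \<noteq> 0"
  shows "fundamental_tensor A F c p y *v w = (grad_R p y \<bullet> w) *\<^sub>R grad_R p y
     + (R p y / \<alpha> p y) *\<^sub>R (a p *v w - (grad_\<alpha> p y \<bullet> w) *\<^sub>R grad_\<alpha> p y)"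
  unfolding vec_eq_iff
  by (simp add: matrix_vector_mult_def fundamental_tensor_entry[OF assms] inner_vec_def
      sum.distrib sum_subtractf sum_distrib_left sum_distrib_right algebra_simps)

lemma partial_x_square:
  assumes "p \<in> S" "y \<noteq> 0"
  shows "partial l (\<lambda>p'. (local_rep A F c p' y)\<^sup>2) p = 2 * R p y * R_x p y (axis l 1)"
proof (rule partial_eqI[OF open_S assms(1)])
  show "((\<lambda>t. (R (p + t *\<^sub>R axis l 1) y)\<^sup>2) has_real_derivative
      2 * R p y * R_x p y (axis l 1)) (at 0)"
    using DERIV_power[OF DERIV_R_x[OF assms], where n = 2] by (simp add: mult_ac)
qed (use local_rep_R in auto)

lemma partial_x_partial_y_square:
  assumes "p \<in> S" "y \<noteq> 0"
  shows "partial m (\<lambda>p'. partial l (\<lambda>y'. (local_rep A F c p' y')\<^sup>2) y) p =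
    2 * (R_x p y (axis m 1) * (grad_R p y \<bullet> axis l 1) + R p y * grad_R_x p y (axis m 1) (axis l 1))"
proof (rule partial_eqI[OF open_S assms(1)])
  show "((\<lambda>t. 2 * R (p + t *\<^sub>R axis m 1) y * (grad_R (p + t *\<^sub>R axis m 1) y \<bullet> axis l 1))
      has_real_derivative 2 * (R_x p y (axis m 1) * (grad_R p y \<bullet> axis l 1)
        + R p y * grad_R_x p y (axis m 1) (axis l 1))) (at 0)"
    using DERIV_cmult[OF DERIV_mult[OF DERIV_R_x[OF assms] DERIV_grad_R_x[OF assms]], of 2 "axis m 1" "axis m 1" "axis l 1"]
    by (simp add: algebra_simps)
qed (use assms partial_y_square in auto)

text \<open>
  Twice the lowered geodesic spray of \<open>a\<close>: the Christoffel symbols of the first kind, contracted with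
  \<open>y\<close> twice.
\<close>

definition geodesic_covector :: "real ^ 'n \<Rightarrow> real ^ 'n \<Rightarrow> real ^ 'n" where
  "geodesic_covector p y = (\<chi> l. (Da p y *v y) $ l - 1/2 * (y \<bullet> (Da p (axis l 1) *v y)))"

text \<open>
  The exterior derivative of \<open>\<beta>\<close> with \<open>y\<close> inserted in its first slot.
\<close>

definition curl :: "real ^ 'n \<Rightarrow> real ^ 'n \<Rightarrow> real ^ 'n" where
  "curl p y = (\<chi> l. D\<beta> p y $ l - D\<beta> p (axis l 1) \<bullet> y)"

definition riemannian_spray :: "real ^ 'n \<Rightarrow> real ^ 'n \<Rightarrow> real ^ 'n" where
  "riemannian_spray p y = (1/2) *\<^sub>R (matrix_inv (a p) *v geodesic_covector p y)"

definition curl_raised :: "real ^ 'n \<Rightarrow> real ^ 'n \<Rightarrow> real ^ 'n" where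
  "curl_raised p y = matrix_inv (a p) *v curl p y"

text \<open>
  Found by comparing the coefficients of the gradient of \<open>F\<close> when the tensor is applied to both sides of
  the spray formula below.
\<close>

definition projective_factor :: "real ^ 'n \<Rightarrow> real ^ 'n \<Rightarrow> real" where
  "projective_factor p y = (R_x p y y / 2 - grad_R p y \<bullet> riemannian_spray p y - \<alpha> p y / 2 * (\<beta> p \<bullet> curl_raised p y)) / R p y"

text \<open>
  The Euler--Lagrange expression of the energy \<open>F\<^sup>2\<close> without its acceleration term; the spray is the
  acceleration, up to sign and factor, that makes the full expression vanish.
\<close>

definition euler_lagrange :: "real ^ 'n \<Rightarrow> real ^ 'n \<Rightarrow> real ^ 'n" where
  "euler_lagrange p y = (\<chi> l. (\<Sum>m\<in>UNIV. partial m (\<lambda>p'. partial l (\<lambda>y'. (local_rep A F c p' y')\<^sup>2) y) p * y $ m)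
        - partial l (\<lambda>p'. (local_rep A F c p' y)\<^sup>2) p)"

lemma spray_matrix_form:
  "spray A F c i p y = ((1/4) *\<^sub>R (matrix_inv (fundamental_tensor A F c p y) *v euler_lagrange p y)) $ i"
  unfolding spray_def euler_lagrange_def by (simp add: matrix_vector_mult_def)

lemma linear_alpha_x: "p \<in> S \<Longrightarrow> linear (\<alpha>_x p y)"
  using linear_Da[of p]
  by (intro linearI) (simp_all add: \<alpha>_x_def linear_add linear_scale matrix_vector_mult_add_rdistrib
      inner_add_right add_divide_distrib flip: scaleR_matrix_vector_assoc)

lemma linear_R_x: "p \<in> S \<Longrightarrow> linear (R_x p y)"
  using linear_alpha_x[of p y] linear_D\<beta>[of p]
  by (intro linearI) (simp_all add: R_x_def linear_add linear_scale inner_add_left algebra_simps)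

lemma linear_grad_R_x:
  assumes "p \<in> S"
  shows "linear (\<lambda>v. grad_R_x p y v w)"
  using linear_alpha_x[OF assms, of y] linear_D\<beta>[OF assms] linear_Da[OF assms]
  by (intro linearI) (simp_all add: grad_R_x_def linear_add linear_scale matrix_vector_mult_add_rdistrib
      inner_add_left inner_add_right add_divide_distrib diff_divide_distrib algebra_simps
      flip: scaleR_matrix_vector_assoc)

text \<open>
  Differentiating \<open>2 F \<nabla>F\<close> along \<open>y\<close> splits off a multiple of the gradient; what remains is \<open>2 F\<close> times the
  Euler--Lagrange expression of \<open>F = \<alpha> + \<beta>\<close> itself, which is additive: \<open>\<beta>\<close> contributes its curl.
\<close>

lemma euler_lagrange_eq:
  assumes "p \<in> S" "y \<noteq> 0"
  shows "euler_lagrange p y = (2 * R_x p y y) *\<^sub>R grad_R p y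
    + (2 * R p y) *\<^sub>R ((1 / \<alpha> p y) *\<^sub>R (geodesic_covector p y - \<alpha>_x p y y *\<^sub>R grad_\<alpha> p y) + curl p y)"
proof -
  \<comment> \<open>By linearity the sum over \<open>m\<close> is the derivative in the base point in direction \<open>y\<close>.\<close>
  have mixed: "(\<Sum>m\<in>UNIV. partial m (\<lambda>p'. partial l (\<lambda>y'. (local_rep A F c p' y')\<^sup>2) y) p * y $ m) =
    2 * (R_x p y y * (grad_R p y \<bullet> axis l 1) + R p y * grad_R_x p y y (axis l 1))" for l
  proof -
    let ?\<phi> = "\<lambda>v. 2 * (R_x p y v * (grad_R p y \<bullet> axis l 1) + R p y * grad_R_x p y v (axis l 1))"
    have "linear ?\<phi>"
      by (rule linearI) (simp_all only: linear_add[OF linear_R_x[OF assms(1)]]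
          linear_scale[OF linear_R_x[OF assms(1)]] linear_add[OF linear_grad_R_x[OF assms(1)]]
          linear_scale[OF linear_grad_R_x[OF assms(1)]] algebra_simps real_scaleR_def)
    from linear_sum_axis[OF this, of y] show ?thesis
      by (simp add: partial_x_partial_y_square[OF assms])
  qed
  show ?thesis
    unfolding vec_eq_iff
  proof
    fix l
    have "euler_lagrange p y $ l = 2 * (R_x p y y * grad_R p y $ l + R p y * grad_R_x p y y (axis l 1))
        - 2 * R p y * R_x p y (axis l 1)"
      unfolding euler_lagrange_def by (simp add: mixed partial_x_square[OF assms] inner_axis_one)
    also have "grad_R_x p y y (axis l 1) =
        ((Da p y *v y) $ l - grad_\<alpha> p y $ l * \<alpha>_x p y y) / \<alpha> p y + D\<beta> p y $ l"
      unfolding grad_R_x_def by (simp add: inner_axis_one inner_axis')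
    also have "R_x p y (axis l 1) =
        (y \<bullet> (Da p (axis l 1) *v y)) / 2 / \<alpha> p y + D\<beta> p (axis l 1) \<bullet> y"
      unfolding R_x_def \<alpha>_x_def by simp
    also have "2 * (R_x p y y * grad_R p y $ l +
          R p y * (((Da p y *v y) $ l - grad_\<alpha> p y $ l * \<alpha>_x p y y) / \<alpha> p y + D\<beta> p y $ l)) -
        2 * R p y * ((y \<bullet> (Da p (axis l 1) *v y)) / 2 / \<alpha> p y + D\<beta> p (axis l 1) \<bullet> y) =
      ((2 * R_x p y y) *\<^sub>R grad_R p y
        + (2 * R p y) *\<^sub>R ((1 / \<alpha> p y) *\<^sub>R (geodesic_covector p y - \<alpha>_x p y y *\<^sub>R grad_\<alpha> p y) + curl p y)) $ l"
      unfolding geodesic_covector_def curl_def by (simp add: diff_divide_distrib algebra_simps)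
    finally show "euler_lagrange p y $ l = \<dots>" .
  qed
qed

lemma inner_geodesic_covector:
  assumes "p \<in> S" "y \<noteq> 0"
  shows "y \<bullet> geodesic_covector p y = \<alpha> p y * \<alpha>_x p y y"
proof -
  have "linear (\<lambda>v. y \<bullet> (Da p v *v y))"
    using linear_Da[OF assms(1)]
    by (intro linearI) (simp_all add: linear_add linear_scale matrix_vector_mult_add_rdistrib
        inner_add_right flip: scaleR_matrix_vector_assoc)
  from linear_sum_axis[OF this, of y]
  have "(\<Sum>l\<in>UNIV. (y \<bullet> (Da p (axis l 1) *v y)) * y $ l) = y \<bullet> (Da p y *v y)" .
  moreover have "y \<bullet> geodesic_covector p y = y \<bullet> (Da p y *v y) -
      1/2 * (\<Sum>l\<in>UNIV. (y \<bullet> (Da p (axis l 1) *v y)) * y $ l)"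
    unfolding geodesic_covector_def inner_vec_def[of y "\<chi> l. _ l"]
    by (simp add: algebra_simps sum_subtractf sum_distrib_left inner_vec_def[of y "Da p y *v y"])
  ultimately show ?thesis
    using alpha_pos[OF assms] unfolding \<alpha>_x_def by simp
qed

lemma inner_curl:
  assumes "p \<in> S"
  shows "curl p y \<bullet> w = D\<beta> p y \<bullet> w - D\<beta> p w \<bullet> y"
proof -
  have "linear (\<lambda>v. D\<beta> p v \<bullet> y)"
    using linear_D\<beta>[OF assms]
    by (intro linearI) (simp_all add: linear_add linear_scale inner_add_left)
  from linear_sum_axis[OF this, of w]
  have "(\<Sum>l\<in>UNIV. (D\<beta> p (axis l 1) \<bullet> y) * w $ l) = D\<beta> p w \<bullet> y" .
  moreover have "curl p y \<bullet> w = D\<beta> p y \<bullet> w - (\<Sum>l\<in>UNIV. (D\<beta> p (axis l 1) \<bullet> y) * w $ l)"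
    unfolding curl_def inner_vec_def[of "\<chi> l. _ l" w]
    by (simp add: algebra_simps sum_subtractf inner_vec_def[of "D\<beta> p y" w])
  ultimately show ?thesis by simp
qed

text \<open>
  The exterior derivative is alternating.
\<close>

lemma inner_curl_self: "p \<in> S \<Longrightarrow> curl p y \<bullet> y = 0"
  by (simp add: inner_curl)

lemma a_riemannian_spray:
  assumes "p \<in> S"
  shows "a p *v riemannian_spray p y = (1/2) *\<^sub>R geodesic_covector p y"
  using matrix_inv_mult_vec(2)[of "a p"] a_positive[OF assms]
  unfolding riemannian_spray_def by (simp add: matrix_vector_mult_scaleR)

lemma a_curl_raised:
  assumes "p \<in> S"
  shows "a p *v curl_raised p y = curl p y"
  using matrix_inv_mult_vec(2)[of "a p"] a_positive[OF assms]
  unfolding curl_raised_def by simp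

lemma inner_grad_alpha:
  assumes "p \<in> S"
  shows "grad_\<alpha> p y \<bullet> w = (y \<bullet> (a p *v w)) / \<alpha> p y"
  using inner_matrix_symmetric[OF a_symmetric[OF assms], of y w]
  unfolding grad_\<alpha>_def by (simp add: inner_commute)

text \<open>
  By homogeneity the tensor evaluates to \<open>F\<^sup>2\<close> on \<open>(y, y)\<close>, so positive definiteness rules out a zero of
  \<open>F\<close>.
\<close>

lemma R_nonzero:
  assumes "p \<in> S" "y \<noteq> 0"
  shows "R p y \<noteq> 0"
proof
  assume R: "R p y = 0"
  have "grad_\<alpha> p y \<bullet> y = \<alpha> p y"
    using inner_grad_alpha[OF assms(1)] alpha_square[OF assms] alpha_pos[OF assms] by simp
  then have "grad_R p y \<bullet> y = 0"
    using R unfolding grad_R_def R_def by (simp add: inner_add_left)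
  then show False
    using tensor_positive[OF assms assms(2)] R by (simp add: fundamental_tensor_mult_vec[OF assms])
qed

lemma tensor_riemannian_spray:
  assumes "p \<in> S" "y \<noteq> 0"
  shows "fundamental_tensor A F c p y *v riemannian_spray p y =
    (grad_R p y \<bullet> riemannian_spray p y) *\<^sub>R grad_R p y
    + (R p y / (2 * \<alpha> p y)) *\<^sub>R (geodesic_covector p y - \<alpha>_x p y y *\<^sub>R grad_\<alpha> p y)"
proof -
  have s: "grad_\<alpha> p y \<bullet> riemannian_spray p y = \<alpha>_x p y y / 2"
    using alpha_pos[OF assms]
    by (simp add: inner_grad_alpha[OF assms(1)] a_riemannian_spray[OF assms(1)]
        inner_geodesic_covector[OF assms])
  show ?thesis
    by (simp add: fundamental_tensor_mult_vec[OF assms] a_riemannian_spray[OF assms(1)] s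
        scaleR_diff_right mult.commute)
qed

lemma tensor_curl_raised:
  assumes "p \<in> S" "y \<noteq> 0"
  shows "fundamental_tensor A F c p y *v curl_raised p y =
    (\<beta> p \<bullet> curl_raised p y) *\<^sub>R grad_R p y + (R p y / \<alpha> p y) *\<^sub>R curl p y"
proof -
  have "grad_\<alpha> p y \<bullet> curl_raised p y = 0"
    using inner_curl_self[OF assms(1)]
    by (simp add: inner_grad_alpha[OF assms(1)] a_curl_raised[OF assms(1)] inner_commute)
  then show ?thesis
    by (simp add: fundamental_tensor_mult_vec[OF assms] a_curl_raised[OF assms(1)]
        grad_R_def inner_add_left)
qed

lemma tensor_self:
  assumes "p \<in> S" "y \<noteq> 0"
  shows "fundamental_tensor A F c p y *v y = R p y *\<^sub>R grad_R p y"
proof -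
  have "grad_\<alpha> p y \<bullet> y = \<alpha> p y"
    using inner_grad_alpha[OF assms(1)] alpha_square[OF assms] alpha_pos[OF assms] by simp
  then show ?thesis
    using alpha_pos[OF assms]
    by (simp add: fundamental_tensor_mult_vec[OF assms] grad_R_def inner_add_left R_def grad_\<alpha>_def)
qed

text \<open>
  The spray of \<open>\<alpha> + \<beta>\<close> differs from the geodesic spray of \<open>a\<close> by a multiple of \<open>y\<close> and by
  \<open>\<alpha>/2\<close> times the curl raised with \<open>a\<close>. Applying the tensor to the right-hand side gives a quarter of the
  Euler--Lagrange expression: the radial term is free to absorb every multiple of the gradient of
  \<open>F\<close>, and the raised curl is \<open>a\<close>-orthogonal to \<open>y\<close>, so the tensor turns it into \<open>F / \<alpha>\<close> times the curl
  up to such a multiple.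
\<close>

proposition spray_formula:
  assumes "p \<in> S" "y \<noteq> 0"
  shows "spray A F c i p y = riemannian_spray p y $ i + \<alpha> p y / 2 * curl_raised p y $ i
     + projective_factor p y * y $ i"
proof -
  let ?M = "fundamental_tensor A F c p y"
  let ?s = "riemannian_spray p y" and ?k = "curl_raised p y" and ?P = "projective_factor p y"
  let ?N = "geodesic_covector p y - \<alpha>_x p y y *\<^sub>R grad_\<alpha> p y"
  have "?M *v (?s + (\<alpha> p y / 2) *\<^sub>R ?k + ?P *\<^sub>R y) =
      ?M *v ?s + (\<alpha> p y / 2) *\<^sub>R (?M *v ?k) + ?P *\<^sub>R (?M *v y)"
    by (simp add: matrix_vector_right_distrib matrix_vector_mult_scaleR)
  also have "\<dots> = (grad_R p y \<bullet> ?s + \<alpha> p y / 2 * (\<beta> p \<bullet> ?k) + ?P * R p y) *\<^sub>R grad_R p y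
      + (R p y / (2 * \<alpha> p y)) *\<^sub>R ?N + (R p y / 2) *\<^sub>R curl p y"
    using alpha_pos[OF assms]
    by (simp add: tensor_riemannian_spray[OF assms] tensor_curl_raised[OF assms] tensor_self[OF assms]
        scaleR_add_left scaleR_add_right)
  also have "grad_R p y \<bullet> ?s + \<alpha> p y / 2 * (\<beta> p \<bullet> ?k) + ?P * R p y = R_x p y y / 2"
    using R_nonzero[OF assms] unfolding projective_factor_def by simp
  also have "(R_x p y y / 2) *\<^sub>R grad_R p y + (R p y / (2 * \<alpha> p y)) *\<^sub>R ?N + (R p y / 2) *\<^sub>R curl p y
      = (1/4) *\<^sub>R euler_lagrange p y"
    by (simp add: euler_lagrange_eq[OF assms] scaleR_add_right)
  finally have "matrix_inv ?M *v (?M *v (?s + (\<alpha> p y / 2) *\<^sub>R ?k + ?P *\<^sub>R y)) =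
      (1/4) *\<^sub>R (matrix_inv ?M *v euler_lagrange p y)"
    by (simp add: matrix_vector_mult_scaleR)
  moreover have "matrix_inv ?M *v (?M *v v) = v" for v
    using matrix_inv_mult_vec(1)[of ?M] tensor_positive[OF assms] by blast
  ultimately have "?s + (\<alpha> p y / 2) *\<^sub>R ?k + ?P *\<^sub>R y = (1/4) *\<^sub>R (matrix_inv ?M *v euler_lagrange p y)"
    by simp
  then show ?thesis
    unfolding spray_matrix_form by (metis vector_add_component vector_scaleR_component real_scaleR_def)
qed

lemma riemannian_spray_quadratic:
  assumes "p \<in> S"
  shows "riemannian_spray p y $ i = 1/2 * (\<Sum>j\<in>UNIV. \<Sum>k\<in>UNIV.
    (\<Sum>l\<in>UNIV. matrix_inv (a p) $ i $ l * (Da p (axis j 1) $ l $ k - 1/2 * Da p (axis l 1) $ j $ k))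
      * y $ j * y $ k)"
proof -
  have g: "geodesic_covector p y $ l = (\<Sum>j\<in>UNIV. \<Sum>k\<in>UNIV.
      (Da p (axis j 1) $ l $ k - 1/2 * Da p (axis l 1) $ j $ k) * y $ j * y $ k)" for l
  proof -
    have "linear (\<lambda>v. (Da p v *v y) $ l)"
      using linear_Da[OF assms]
      by (intro linearI) (simp_all add: linear_add linear_scale matrix_vector_mult_add_rdistrib
          flip: scaleR_matrix_vector_assoc)
    from linear_sum_axis[OF this, of y]
    have "(Da p y *v y) $ l = (\<Sum>j\<in>UNIV. (Da p (axis j 1) *v y) $ l * y $ j)" by simp
    also have "\<dots> = (\<Sum>j\<in>UNIV. \<Sum>k\<in>UNIV. Da p (axis j 1) $ l $ k * y $ j * y $ k)"
      by (simp add: matrix_vector_mult_def sum_distrib_left sum_distrib_right mult_ac)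
    finally have 1: "(Da p y *v y) $ l =
        (\<Sum>j\<in>UNIV. \<Sum>k\<in>UNIV. Da p (axis j 1) $ l $ k * y $ j * y $ k)" .
    have 2: "y \<bullet> (Da p (axis l 1) *v y) =
        (\<Sum>j\<in>UNIV. \<Sum>k\<in>UNIV. Da p (axis l 1) $ j $ k * y $ j * y $ k)"
      by (simp add: inner_vec_def matrix_vector_mult_def sum_distrib_left mult_ac)
    show ?thesis
      unfolding geodesic_covector_def
      by (simp only: vec_lambda_beta 1 2 sum_distrib_left sum_subtractf left_diff_distrib mult.assoc)
  qed
  have "riemannian_spray p y $ i = 1/2 * (\<Sum>l\<in>UNIV. matrix_inv (a p) $ i $ l * geodesic_covector p y $ l)"
    unfolding riemannian_spray_def by (simp add: matrix_vector_mult_def)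
  also have "(\<Sum>l\<in>UNIV. matrix_inv (a p) $ i $ l * geodesic_covector p y $ l) =
     (\<Sum>l\<in>UNIV. \<Sum>j\<in>UNIV. \<Sum>k\<in>UNIV. matrix_inv (a p) $ i $ l *
       ((Da p (axis j 1) $ l $ k - 1/2 * Da p (axis l 1) $ j $ k) * y $ j * y $ k))"
    by (simp only: g sum_distrib_left)
  also have "\<dots> = (\<Sum>j\<in>UNIV. \<Sum>l\<in>UNIV. \<Sum>k\<in>UNIV. matrix_inv (a p) $ i $ l *
       ((Da p (axis j 1) $ l $ k - 1/2 * Da p (axis l 1) $ j $ k) * y $ j * y $ k))"
    by (rule sum.swap)
  also have "\<dots> = (\<Sum>j\<in>UNIV. \<Sum>k\<in>UNIV. \<Sum>l\<in>UNIV. matrix_inv (a p) $ i $ l *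
       ((Da p (axis j 1) $ l $ k - 1/2 * Da p (axis l 1) $ j $ k) * y $ j * y $ k))"
    by (rule sum.cong[OF refl]) (rule sum.swap)
  also have "\<dots> = (\<Sum>j\<in>UNIV. \<Sum>k\<in>UNIV.
    (\<Sum>l\<in>UNIV. matrix_inv (a p) $ i $ l * (Da p (axis j 1) $ l $ k - 1/2 * Da p (axis l 1) $ j $ k))
      * y $ j * y $ k)"
    by (simp add: sum_distrib_right mult.assoc)
  finally show ?thesis .
qed

lemma projective_factor_homogeneous:
  assumes "p \<in> S" "r > 0"
  shows "projective_factor p (r *\<^sub>R y) = r * projective_factor p y"
proof -
  have alpha: "\<alpha> p (r *\<^sub>R y) = r * \<alpha> p y"
    using assms(2) unfolding \<alpha>_def
    by (simp add: matrix_vector_mult_scaleR real_sqrt_mult)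
  have DaS: "Da p (r *\<^sub>R y) = r *\<^sub>R Da p y" and DbS: "D\<beta> p (r *\<^sub>R y) = r *\<^sub>R D\<beta> p y"
    using linear_scale linear_Da[OF assms(1)] linear_D\<beta>[OF assms(1)] by blast+
  have R: "R p (r *\<^sub>R y) = r * R p y"
    unfolding R_def by (simp add: alpha algebra_simps)
  have gR: "grad_R p (r *\<^sub>R y) = grad_R p y"
    using assms(2) unfolding grad_R_def grad_\<alpha>_def by (simp add: alpha matrix_vector_mult_scaleR)
  have g: "geodesic_covector p (r *\<^sub>R y) = (r * r) *\<^sub>R geodesic_covector p y"
    unfolding geodesic_covector_def vec_eq_iff
    by (simp add: DaS matrix_vector_mult_scaleR algebra_simps flip: scaleR_matrix_vector_assoc)
  have s: "riemannian_spray p (r *\<^sub>R y) = (r * r) *\<^sub>R riemannian_spray p y"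
    unfolding riemannian_spray_def g by (simp add: matrix_vector_mult_scaleR)
  have c: "curl p (r *\<^sub>R y) = r *\<^sub>R curl p y"
    unfolding curl_def vec_eq_iff by (simp add: DbS algebra_simps)
  have k: "curl_raised p (r *\<^sub>R y) = r *\<^sub>R curl_raised p y"
    unfolding curl_raised_def c by (simp add: matrix_vector_mult_scaleR)
  have Rx: "R_x p (r *\<^sub>R y) (r *\<^sub>R y) = r * r * R_x p y y"
    using assms(2) unfolding R_x_def \<alpha>_x_def
    by (simp add: alpha DaS DbS matrix_vector_mult_scaleR algebra_simps flip: scaleR_matrix_vector_assoc)
  have "projective_factor p (r *\<^sub>R y) = (r * r * R_x p y y / 2 - (r * r) * (grad_R p y \<bullet> riemannian_spray p y)
      - r * \<alpha> p y / 2 * (r * (\<beta> p \<bullet> curl_raised p y))) / (r * R p y)"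
    unfolding projective_factor_def Rx gR s k alpha R by simp
  also have "\<dots> = (r * (r * (R_x p y y / 2 - grad_R p y \<bullet> riemannian_spray p y
      - \<alpha> p y / 2 * (\<beta> p \<bullet> curl_raised p y)))) / (r * R p y)"
    by (simp add: algebra_simps)
  also have "\<dots> = r * projective_factor p y"
    using assms(2) unfolding projective_factor_def by simp
  finally show ?thesis .
qed

text \<open>
  Parity separates the terms. Under \<open>y \<mapsto> -y\<close> quadratic forms and the geodesic spray are even, while \<open>\<alpha>\<close>
  times the raised curl is odd. Hence the latter is radial; being \<open>a\<close>-orthogonal to \<open>y\<close>, it vanishes.
\<close>

lemma curl_zero_of_quadratic_spray:
  assumes p: "p \<in> S" and y: "y \<noteq> 0"
    and douglas: "\<And>y i. y \<noteq> 0 \<Longrightarrow> spray A F c i p y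
       = 1/2 * (\<Sum>j\<in>UNIV. \<Sum>k\<in>UNIV. \<Gamma> i j k * y $ j * y $ k) + Q y * y $ i"
  shows "curl p y = 0"
proof -
  \<comment> \<open>The odd part of the Douglas equation at \<open>y\<close> and \<open>-y\<close> leaves this radial coefficient.\<close>
  let ?\<mu> = "Q y + Q (- y) - projective_factor p y - projective_factor p (- y)"
  have my: "- y \<noteq> 0"
    using y by simp
  have even: "riemannian_spray p (- y) $ i = riemannian_spray p y $ i" for i
    by (simp add: riemannian_spray_quadratic[OF p])
  have alpha: "\<alpha> p (- y) = \<alpha> p y"
    unfolding \<alpha>_def by (simp add: matrix_vector_mult_neg)
  have "curl p (- y) = - curl p y"
    unfolding curl_def vec_eq_iff by (simp add: linear_neg[OF linear_D\<beta>[OF p]])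
  then have odd: "curl_raised p (- y) = - curl_raised p y"
    unfolding curl_raised_def by (simp add: matrix_vector_mult_neg)
  have "\<alpha> p y * curl_raised p y $ i = ?\<mu> * y $ i" for i
    using spray_formula[OF p y, of i] spray_formula[OF p my, of i] douglas[OF y, of i]
      douglas[OF my, of i] even[of i]
    by (simp add: alpha odd algebra_simps)
  then have eq: "\<alpha> p y *\<^sub>R curl_raised p y = ?\<mu> *\<^sub>R y"
    by (simp add: vec_eq_iff)
  have "y \<bullet> (a p *v (\<alpha> p y *\<^sub>R curl_raised p y)) = \<alpha> p y * (curl p y \<bullet> y)"
    by (simp add: matrix_vector_mult_scaleR a_curl_raised[OF p] inner_commute)
  then have "?\<mu> * (y \<bullet> (a p *v y)) = 0"
    using eq inner_curl_self[OF p] by (simp add: matrix_vector_mult_scaleR)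
  then have "?\<mu> = 0"
    using a_positive[OF p y] by simp
  then have "curl_raised p y = 0"
    using eq alpha_pos[OF p y] by simp
  then show ?thesis
    using a_curl_raised[OF p, of y] by simp
qed

text \<open>
  The spray of \<open>\<alpha> + \<beta>\<close> is quadratic up to a radial term if and only if \<open>\<beta>\<close> is closed, a theorem of
  Bacso and Matsumoto.
\<close>

proposition douglas_iff_closed:
  "(\<exists>(\<Gamma> :: real ^ 'n \<Rightarrow> 'n \<Rightarrow> 'n \<Rightarrow> 'n \<Rightarrow> real) (P :: real ^ 'n \<Rightarrow> real ^ 'n \<Rightarrow> real).
       (\<forall>p\<in>S. \<forall>y r. y \<noteq> 0 \<longrightarrow> r > 0 \<longrightarrow> P p (r *\<^sub>R y) = r * P p y) \<and>
       (\<forall>p\<in>S. \<forall>y i. y \<noteq> 0 \<longrightarrow>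
          spray A F c i p y
            = 1/2 * (\<Sum>j\<in>UNIV. \<Sum>k\<in>UNIV. \<Gamma> p i j k * y $ j * y $ k) + P p y * y $ i))
   \<longleftrightarrow> (\<forall>p\<in>S. \<forall>v w. D\<beta> p v \<bullet> w = D\<beta> p w \<bullet> v)" (is "?douglas \<longleftrightarrow> ?closed")
proof
  assume ?douglas
  then obtain \<Gamma> :: "real ^ 'n \<Rightarrow> 'n \<Rightarrow> 'n \<Rightarrow> 'n \<Rightarrow> real" and Q :: "real ^ 'n \<Rightarrow> real ^ 'n \<Rightarrow> real"
    where d: "\<And>p y i. p \<in> S \<Longrightarrow> y \<noteq> 0 \<Longrightarrow> spray A F c i p y
            = 1/2 * (\<Sum>j\<in>UNIV. \<Sum>k\<in>UNIV. \<Gamma> p i j k * y $ j * y $ k) + Q p y * y $ i"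
    by blast
  show ?closed
  proof (intro ballI allI)
    fix p v w assume p: "p \<in> S"
    show "D\<beta> p v \<bullet> w = D\<beta> p w \<bullet> v"
    proof (cases "v = 0")
      case True
      then show ?thesis
        using linear_0[OF linear_D\<beta>[OF p]] by simp
    next
      case False
      have "curl p v = 0"
        using curl_zero_of_quadratic_spray[OF p False, of "\<Gamma> p" "Q p"] d[OF p] by blast
      then show ?thesis
        using inner_curl[OF p, of v w] by simp
    qed
  qed
next
  assume closed: ?closed
  define \<Gamma> where "\<Gamma> p i j k = (\<Sum>l\<in>UNIV. matrix_inv (a p) $ i $ l *
    (Da p (axis j 1) $ l $ k - 1/2 * Da p (axis l 1) $ j $ k))" for p and i j k :: 'n
  have "curl_raised p y = 0" if "p \<in> S" for p y
  proof -
    have "curl p y = 0"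
      using inner_curl[OF that, of y "curl p y"] closed that by simp
    then show ?thesis
      unfolding curl_raised_def by simp
  qed
  then have "spray A F c i p y
      = 1/2 * (\<Sum>j\<in>UNIV. \<Sum>k\<in>UNIV. \<Gamma> p i j k * y $ j * y $ k) + projective_factor p y * y $ i"
    if "p \<in> S" "y \<noteq> 0" for p y i
    using spray_formula[OF that] that riemannian_spray_quadratic[OF that(1), of y i]
    unfolding \<Gamma>_def by simp
  then show ?douglas
    using projective_factor_homogeneous by blast
qed

end

section \<open>Left invariant Randers metrics\<close>

lemma differentiable_vec_lambda:
  fixes f :: "'n::finite \<Rightarrow> 'e::euclidean_space \<Rightarrow> 'f::euclidean_space"
  assumes "\<And>i. f i differentiable (at x)"
  shows "(\<lambda>p. \<chi> i. f i p) differentiable (at x)"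
proof -
  have "(\<lambda>p. (\<chi> i. f i p) \<bullet> b) differentiable (at x)" if B: "b \<in> Basis" for b
  proof -
    obtain i u where b: "b = axis i u"
      using B unfolding Basis_vec_def by blast
    have "((\<lambda>p. f i p \<bullet> u) has_derivative (\<lambda>v. frechet_derivative (f i) (at x) v \<bullet> u)) (at x)"
      using frechet_has_derivative[OF assms] by (rule has_derivative_inner_left)
    then show ?thesis
      unfolding b inner_axis using differentiableI by auto
  qed
  then show ?thesis
    using differentiable_componentwise_within by blast
qed

locale invariant_metric_and_field = lie_group G T A
  for G :: "('a, 'm) monoid_scheme" (structure)
    and T :: "'a topology" and A :: "('a, real ^ 'n) chart set" +
  fixes g :: "'a \<Rightarrow> ('a, real ^ 'n) tangent \<Rightarrow> ('a, real ^ 'n) tangent \<Rightarrow> real"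
    and X :: "'a \<Rightarrow> ('a, real ^ 'n) tangent"
  assumes metric: "left_invariant_riemannian_metric G A g"
    and field: "left_invariant_field G A X"
begin

lemma carrier_eq: "carrier G = (\<Union>c\<in>A. cdom c)"
  using cover topspace_eq by simp

lemma X_in_lie_algebra: "X \<in> lie_algebra G A"
  using field unfolding lie_algebra_def by simp

lemma X_equivariant: "X \<in> equivariant_fields"
  using X_in_lie_algebra lie_algebra_equivariant by blast

lemma riemannian_at:
  assumes "x \<in> carrier G"
  shows "(\<forall>v\<in>tangent_space A x. \<forall>w\<in>tangent_space A x. g x v w = g x w v) \<and>
    (\<forall>u\<in>tangent_space A x. \<forall>v\<in>tangent_space A x. \<forall>w\<in>tangent_space A x. \<forall>r.
       g x (r *\<^sub>R u + v) w = r * g x u w + g x v w) \<and>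
    (\<forall>v\<in>tangent_space A x. v \<noteq> 0 \<longrightarrow> g x v v > 0)"
proof -
  have "riemannian_metric A g"
    using metric unfolding left_invariant_riemannian_metric_def by (rule conjunct1)
  from conjunct1[OF this[unfolded riemannian_metric_def]] show ?thesis
    using assms unfolding carrier_eq by (rule bspec)
qed

lemma metric_sym:
  assumes "x \<in> carrier G" "v \<in> tangent_space A x" "w \<in> tangent_space A x"
  shows "g x v w = g x w v"
  by (rule bspec[OF bspec[OF conjunct1[OF riemannian_at[OF assms(1)]] assms(2)] assms(3)])

lemma metric_add_scale:
  assumes "x \<in> carrier G" "u \<in> tangent_space A x" "v \<in> tangent_space A x" "w \<in> tangent_space A x"
  shows "g x (r *\<^sub>R u + v) w = r * g x u w + g x v w"
  by (rule spec[OF bspec[OF bspec[OF bspec[OF conjunct1[OF conjunct2[OF riemannian_at[OF assms(1)]]]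
      assms(2)] assms(3)] assms(4)]])

lemma metric_pos:
  assumes "x \<in> carrier G" "v \<in> tangent_space A x" "v \<noteq> 0"
  shows "g x v v > 0"
  using riemannian_at[OF assms(1)] assms(2,3) by blast

lemma metric_equivariant_const:
  assumes Y: "Y \<in> equivariant_fields" and Z: "Z \<in> equivariant_fields" and x: "x \<in> carrier G"
  shows "g x (Y x) (Z x) = g \<one> (Y \<one>) (Z \<one>)"
proof -
  have "g (x \<otimes> \<one>) (differential A A (\<lambda>z. x \<otimes> z) \<one> (Y \<one>)) (differential A A (\<lambda>z. x \<otimes> z) \<one> (Z \<one>))
      = g \<one> (Y \<one>) (Z \<one>)"
    using metric x one_closed equivariant_tangent[OF Y one_closed] equivariant_tangent[OF Z one_closed]
    unfolding left_invariant_riemannian_metric_def by blast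
  then show ?thesis
    using equivariant_from_one[OF Y x] equivariant_from_one[OF Z x] x by simp
qed

text \<open>
  The matrix of \<open>g\<close> and the coefficients of the one-form \<open>g(X, \<cdot>)\<close> in the chart \<open>c\<close>.
\<close>

definition gram :: "('a, real ^ 'n) chart \<Rightarrow> real ^ 'n \<Rightarrow> real ^ 'n ^ 'n" where
  "gram c p = (\<chi> i j. g (cinv c p) (coord_vec A c (cinv c p) (axis i 1))
     (coord_vec A c (cinv c p) (axis j 1)))"

definition form :: "('a, real ^ 'n) chart \<Rightarrow> real ^ 'n \<Rightarrow> real ^ 'n" where
  "form c p = gram c p *v X (cinv c p) c"

lemma cinv_carrier: "c \<in> A \<Longrightarrow> p \<in> cran c \<Longrightarrow> cinv c p \<in> carrier G"
  using cinv_in_cdom[of p c] cdom_subset topspace_eq by blast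

lemma coord_vec_tangent:
  "c \<in> A \<Longrightarrow> p \<in> cran c \<Longrightarrow> coord_vec A c (cinv c p) y \<in> tangent_space A (cinv c p)"
  by (rule coord_vec_in_tangent_space[OF _ cinv_in_cdom])

lemma metric_coord:
  assumes c: "c \<in> A" "p \<in> cran c"
  shows "g (cinv c p) (coord_vec A c (cinv c p) y) (coord_vec A c (cinv c p) w) = y \<bullet> (gram c p *v w)"
proof -
  let ?x = "cinv c p" and ?v = "coord_vec A c (cinv c p)"
  note x = cinv_carrier[OF c] and t = coord_vec_tangent[OF c]
  have add: "?v (r *\<^sub>R y + w) = r *\<^sub>R ?v y + ?v w" for r y w
    by (rule coord_vec_add_scale[OF c(1) cinv_in_cdom[OF c(2)]])
  have lin: "linear (\<lambda>y. g ?x (?v y) (?v w))" for w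
  proof (rule linearI)
    have zero: "g ?x (?v 0) (?v w) = 0"
      using add[of 1 0 0] metric_add_scale[OF x t t t, of 1 0 0 w] by simp
    show "g ?x (?v (y + y')) (?v w) = g ?x (?v y) (?v w) + g ?x (?v y') (?v w)" for y y'
      using add[of 1 y y'] metric_add_scale[OF x t t t, of 1 y y' w] by simp
    show "g ?x (?v (r *\<^sub>R y)) (?v w) = r *\<^sub>R g ?x (?v y) (?v w)" for r y
      using add[of r y 0] metric_add_scale[OF x t t t, of r y 0 w] zero by simp
  qed
  have "g ?x (?v y) (?v w) = (\<Sum>i\<in>UNIV. g ?x (?v (axis i 1)) (?v w) * y $ i)"
    using linear_sum_axis[OF lin] by simp
  also have "\<dots> = (\<Sum>i\<in>UNIV. (\<Sum>j\<in>UNIV. g ?x (?v (axis i 1)) (?v (axis j 1)) * w $ j) * y $ i)"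
  proof (rule sum.cong[OF refl])
    fix i
    have "g ?x (?v (axis i 1)) (?v w) = g ?x (?v w) (?v (axis i 1))"
      by (rule metric_sym[OF x t t])
    also have "\<dots> = (\<Sum>j\<in>UNIV. g ?x (?v (axis j 1)) (?v (axis i 1)) * w $ j)"
      using linear_sum_axis[OF lin] by simp
    also have "\<dots> = (\<Sum>j\<in>UNIV. g ?x (?v (axis i 1)) (?v (axis j 1)) * w $ j)"
      by (rule sum.cong[OF refl]) (simp add: metric_sym[OF x t t])
    finally show "g ?x (?v (axis i 1)) (?v w) * y $ i =
        (\<Sum>j\<in>UNIV. g ?x (?v (axis i 1)) (?v (axis j 1)) * w $ j) * y $ i" by simp
  qed
  also have "\<dots> = y \<bullet> (gram c p *v w)"
    unfolding gram_def by (simp add: inner_vec_def matrix_vector_mult_def mult.commute)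
  finally show ?thesis .
qed

lemma transpose_gram:
  assumes c: "c \<in> A" "p \<in> cran c"
  shows "transpose (gram c p) = gram c p"
  using metric_sym[OF cinv_carrier[OF c] coord_vec_tangent[OF c] coord_vec_tangent[OF c]]
  unfolding gram_def transpose_def by (simp add: vec_eq_iff)

lemma metric_chart:
  assumes c: "c \<in> A" "x \<in> cdom c" and v: "v \<in> tangent_space A x" and w: "w \<in> tangent_space A x"
  shows "g x v w = v c \<bullet> (gram c (cmap c x) *v w c)"
  using metric_coord[OF c(1), of "cmap c x" "v c" "w c"] coord_vec_of_tangent[OF c v]
    coord_vec_of_tangent[OF c w] c by simp

lemma form_chart:
  assumes c: "c \<in> A" "x \<in> cdom c" and w: "w \<in> tangent_space A x"
  shows "g x (X x) w = form c (cmap c x) \<bullet> w c"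
proof -
  have "x \<in> carrier G"
    using c cdom_subset topspace_eq by blast
  then have "g x (X x) w = X x c \<bullet> (gram c (cmap c x) *v w c)"
    using metric_chart[OF c equivariant_tangent[OF X_equivariant] w] by simp
  also have "\<dots> = w c \<bullet> (gram c (cmap c x) *v X x c)"
    by (rule inner_matrix_symmetric[OF transpose_gram[OF c(1) imageI[OF c(2)]]])
  finally show ?thesis
    unfolding form_def using c by (simp add: inner_commute)
qed

lemma gram_differentiable:
  assumes c: "c \<in> A" "p \<in> cran c"
  shows "gram c differentiable (at p)"
proof -
  have "(\<lambda>p. g (cinv c p) (coord_vec A c (cinv c p) (axis i 1))
     (coord_vec A c (cinv c p) (axis j 1))) differentiable (at p)" for i j :: 'n
  proof -
    have "smooth_on (cran c) (\<lambda>p. g (cinv c p) (coord_vec A c (cinv c p) (axis i 1))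
       (coord_vec A c (cinv c p) (axis j 1)))"
      using metric c(1) unfolding left_invariant_riemannian_metric_def riemannian_metric_def by simp
    then show ?thesis
      using smooth_on_imp_differentiable c(2) by blast
  qed
  then have "(\<lambda>p. \<chi> i j. g (cinv c p) (coord_vec A c (cinv c p) (axis i 1))
     (coord_vec A c (cinv c p) (axis j 1))) differentiable (at p)"
    by (intro differentiable_vec_lambda)
  then show ?thesis
    unfolding gram_def[abs_def] .
qed

lemma field_differentiable:
  assumes "Y \<in> lie_algebra G A" "c \<in> A" "p \<in> cran c"
  shows "(\<lambda>p. Y (cinv c p) c) differentiable (at p)"
proof -
  have "smooth_on (cran c) (\<lambda>p. Y (cinv c p) c)"
    using assms unfolding lie_algebra_def left_invariant_field_def vector_field_def by blast
  then show ?thesis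
    using smooth_on_imp_differentiable assms(3) by blast
qed

lemma form_differentiable:
  assumes c: "c \<in> A" "p \<in> cran c"
  shows "form c differentiable (at p)"
proof -
  have bil: "bounded_bilinear ((*v) :: real ^ 'n ^ 'n \<Rightarrow> real ^ 'n \<Rightarrow> real ^ 'n)"
    unfolding bilinear_conv_bounded_bilinear[symmetric] bilinear_def
    by (auto intro!: linearI simp: matrix_vector_mult_add_rdistrib matrix_vector_right_distrib
        matrix_vector_mult_scaleR simp flip: scaleR_matrix_vector_assoc)
  have "(\<lambda>p. gram c p *v X (cinv c p) c) differentiable (at p)"
    using bounded_bilinear.FDERIV[OF bil frechet_has_derivative[OF gram_differentiable[OF c]]
        frechet_has_derivative[OF field_differentiable[OF X_in_lie_algebra c]]]
    by (rule differentiableI)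
  then show ?thesis
    unfolding form_def[abs_def] .
qed

text \<open>
  For left invariant \<open>Y\<close> and \<open>Z\<close> the functions \<open>\<beta>(Y)\<close> and \<open>\<beta>(Z)\<close> are constant, so only the bracket
  survives in \<open>d\<beta>(Y, Z) = Y \<beta>(Z) - Z \<beta>(Y) - \<beta>([Y, Z])\<close>.
\<close>

lemma form_derivative_bracket:
  assumes Y: "Y \<in> lie_algebra G A" and Z: "Z \<in> lie_algebra G A" and c: "c \<in> A" "x \<in> cdom c"
  shows "frechet_derivative (form c) (at (cmap c x)) (Y x c) \<bullet> Z x c
    - frechet_derivative (form c) (at (cmap c x)) (Z x c) \<bullet> Y x c
    = - (form c (cmap c x) \<bullet> lie_bracket A Y Z x c)"
proof -
  let ?p = "cmap c x" and ?D = "frechet_derivative (form c) (at (cmap c x))"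
  have p: "?p \<in> cran c"
    using c by blast
  \<comment> \<open>The product rule for the constant function \<open>\<beta>(W)\<close> trades derivatives of \<open>\<beta>\<close> for those of \<open>W\<close>.\<close>
  have key: "?D v \<bullet> W x c = - (form c ?p \<bullet> frechet_derivative (\<lambda>p. W (cinv c p) c) (at ?p) v)"
    if W: "W \<in> lie_algebra G A" for W v
  proof -
    let ?W = "\<lambda>p. W (cinv c p) c"
    have WE: "W \<in> equivariant_fields"
      using W lie_algebra_equivariant by blast
    have const: "form c q \<bullet> ?W q = g \<one> (X \<one>) (W \<one>)" if q: "q \<in> cran c" for q
    proof -
      have G: "cinv c q \<in> carrier G"
        by (rule cinv_carrier[OF c(1) q])
      have "g (cinv c q) (X (cinv c q)) (W (cinv c q)) = form c q \<bullet> ?W q"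
        using form_chart[OF c(1) cinv_in_cdom[OF q] equivariant_tangent[OF WE G]] cmap_cinv[OF q]
        by simp
      then show ?thesis
        using metric_equivariant_const[OF X_equivariant WE G] by simp
    qed
    have "((\<lambda>q. form c q \<bullet> ?W q) has_derivative
        (\<lambda>v. form c ?p \<bullet> frechet_derivative ?W (at ?p) v + ?D v \<bullet> ?W ?p)) (at ?p)"
      by (rule has_derivative_inner[OF frechet_has_derivative[OF form_differentiable[OF c(1) p]]
            frechet_has_derivative[OF field_differentiable[OF W c(1) p]]])
    moreover have "((\<lambda>q. form c q \<bullet> ?W q) has_derivative (\<lambda>v. 0)) (at ?p)"
      by (rule has_derivative_eq_on_open[OF open_cran[OF c(1)] p const[symmetric]])
        simp_all
    ultimately have "(\<lambda>v. form c ?p \<bullet> frechet_derivative ?W (at ?p) v + ?D v \<bullet> ?W ?p) = (\<lambda>v. 0)"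
      by (rule has_derivative_unique)
    from fun_cong[OF this, of v] show ?thesis
      using c by simp
  qed
  show ?thesis
    using c by (simp add: key[OF Y] key[OF Z] lie_bracket_def inner_diff_right)
qed

lemma local_randersI:
  assumes F: "\<forall>x\<in>carrier G. \<forall>y\<in>tangent_space A x. F x y = randers g X x y"
    and finsler: "finsler_metric A F" and c: "c \<in> A"
  shows "local_randers A F c (cran c) (gram c) (form c)"
proof
  show "open (cran c)"
    using open_cran c by blast
next
  fix p assume p: "p \<in> cran c"
  show "gram c differentiable (at p)" "form c differentiable (at p)" "transpose (gram c p) = gram c p"
    by (rule gram_differentiable[OF c p] form_differentiable[OF c p] transpose_gram[OF c p])+
  fix y :: "real ^ 'n"
  note t = coord_vec_tangent[OF c p, of y] and x = cinv_in_cdom[OF p] and xG = cinv_carrier[OF c p]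
  have vc: "coord_vec A c (cinv c p) y c = y"
    using coord_vec_chart[OF c x] .
  show "local_rep A F c p y = sqrt (y \<bullet> (gram c p *v y)) + form c p \<bullet> y"
    using F xG t form_chart[OF c x t] metric_coord[OF c p, of y y] cmap_cinv[OF p] vc
    unfolding local_rep_def randers_def by simp
  assume y: "y \<noteq> 0"
  have "coord_vec A c (cinv c p) y \<noteq> 0"
    using vc y by (metis zero_fun_apply)
  then show "y \<bullet> (gram c p *v y) > 0"
    using metric_pos[OF xG t] metric_coord[OF c p, of y y] by simp
  fix w :: "real ^ 'n" assume "w \<noteq> 0"
  then show "w \<bullet> (fundamental_tensor A F c p y *v w) > 0"
    using finsler c p y unfolding finsler_metric_def by blast
qed

end

section \<open>Closedness and the direction of \<open>b\<close>\<close>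

locale G1_randers = invariant_metric_and_field G T A g X
  for G :: "('a, 'm) monoid_scheme" (structure)
    and T :: "'a topology" and A :: "('a, real ^ 'n) chart set" and g X +
  fixes b :: "'a \<Rightarrow> ('a, real ^ 'n) tangent"
    and U :: "('a \<Rightarrow> ('a, real ^ 'n) tangent) set"
  assumes b: "b \<in> lie_algebra G A" "b \<noteq> 0"
    and ideal: "lie_ideal G A U" and comm: "commutative_subset A U" and codim: "codim_one G A U"
    and bracket_b: "z \<in> U \<Longrightarrow> lie_bracket A b z = z"
    and b_orth: "z \<in> U \<Longrightarrow> g \<one> (b \<one>) (z \<one>) = 0"
begin

lemma U_lie_algebra: "z \<in> U \<Longrightarrow> z \<in> lie_algebra G A"
  using ideal unfolding lie_ideal_def by blast

lemma U_equivariant: "z \<in> U \<Longrightarrow> z \<in> equivariant_fields"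
  using U_lie_algebra lie_algebra_equivariant by blast

lemma b_equivariant: "b \<in> equivariant_fields"
  using b lie_algebra_equivariant by blast

lemma b_notin_U: "b \<notin> U"
  using bracket_b[of b] comm b(2) unfolding commutative_subset_def by metis

lemma decomposition:
  assumes "Y \<in> equivariant_fields"
  obtains r z where "z \<in> U" "Y = r *\<^sub>R b + z"
  using equivariant_decomposition[OF b(1) b_notin_U _ _ codim assms] ideal
  unfolding lie_ideal_def by blast

text \<open>
  The frame \<open>b, U\<close> spans every tangent space, and all its brackets lie in \<open>U\<close>, where \<open>\<beta> = g(r b, \<cdot>)\<close> vanishes.
\<close>

lemma span_b_imp_closed:
  assumes X: "X \<in> span {b}" and c: "c \<in> A" "p \<in> cran c"
  shows "frechet_derivative (form c) (at p) v \<bullet> w = frechet_derivative (form c) (at p) w \<bullet> v"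
proof -
  let ?D = "frechet_derivative (form c) (at p)" and ?x = "cinv c p"
  obtain r where r: "X = r *\<^sub>R b"
    using X by (auto simp: span_singleton)
  note x = cinv_in_cdom[OF c(2)] and xG = cinv_carrier[OF c] and xp = cmap_cinv[OF c(2)]
  have bz: "?D (b ?x c) \<bullet> z ?x c = ?D (z ?x c) \<bullet> b ?x c" if z: "z \<in> U" for z
  proof -
    have "form c p \<bullet> z ?x c = g ?x (X ?x) (z ?x)"
      using form_chart[OF c(1) x equivariant_tangent[OF U_equivariant[OF z] xG]] xp by simp
    also have "\<dots> = g \<one> (X \<one>) (z \<one>)"
      by (rule metric_equivariant_const[OF X_equivariant U_equivariant[OF z] xG])
    also have "\<dots> = g \<one> (r *\<^sub>R b \<one> + 0) (z \<one>)"
      by (simp add: r scaleR_fun_def)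
    also have "\<dots> = r * g \<one> (b \<one>) (z \<one>) + g \<one> 0 (z \<one>)"
      by (rule metric_add_scale[OF one_closed equivariant_tangent[OF b_equivariant one_closed]
            zero_in_tangent_space equivariant_tangent[OF U_equivariant[OF z] one_closed]])
    also have "g \<one> 0 (z \<one>) = 0"
      using metric_add_scale[OF one_closed zero_in_tangent_space zero_in_tangent_space
          equivariant_tangent[OF U_equivariant[OF z] one_closed], of 1] by simp
    finally have "form c p \<bullet> z ?x c = 0"
      using b_orth[OF z] by simp
    then show ?thesis
      using form_derivative_bracket[OF b(1) U_lie_algebra[OF z] c(1) x] bracket_b[OF z] xp by simp
  qed
  have zz: "?D (z ?x c) \<bullet> z' ?x c = ?D (z' ?x c) \<bullet> z ?x c" if "z \<in> U" "z' \<in> U" for z z'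
  proof -
    have "lie_bracket A z z' = 0"
      using comm that unfolding commutative_subset_def by blast
    then show ?thesis
      using form_derivative_bracket[OF U_lie_algebra[OF that(1)] U_lie_algebra[OF that(2)] c(1) x] xp
      by simp
  qed
  have frame: "\<exists>s z. z \<in> U \<and> v = s *\<^sub>R b ?x c + z ?x c" for v
  proof -
    obtain V where V: "V \<in> equivariant_fields" "V ?x = coord_vec A c ?x v"
      using equivariant_through_vector[OF xG coord_vec_tangent[OF c]] by blast
    obtain s z where "z \<in> U" "V = s *\<^sub>R b + z"
      using decomposition[OF V(1)] by blast
    moreover have "V ?x c = v"
      using V(2) coord_vec_chart[OF c(1) x] by simp
    ultimately show ?thesis
      by (auto simp: scaleR_fun_def)
  qed
  obtain s z where v: "z \<in> U" "v = s *\<^sub>R b ?x c + z ?x c"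
    using frame by blast
  obtain s' z' where w: "z' \<in> U" "w = s' *\<^sub>R b ?x c + z' ?x c"
    using frame by blast
  have "linear ?D"
    using form_differentiable[OF c] by (rule linear_frechet_derivative)
  then show ?thesis
    using bz[OF v(1)] bz[OF w(1)] zz[OF v(1) w(1)] unfolding v(2) w(2)
    by (simp add: linear_add linear_scale inner_add_left inner_add_right)
qed

text \<open>
  Since \<open>z = [b, z]\<close>, closedness yields \<open>\<beta>(z) = - d\<beta>(b, z) = 0\<close>: the field \<open>X\<close> is orthogonal to \<open>U\<close>, whose
  orthogonal complement is spanned by \<open>b\<close>.
\<close>

lemma closed_imp_span_b:
  assumes closed: "\<And>c p v w. c \<in> A \<Longrightarrow> p \<in> cran c \<Longrightarrow>
    frechet_derivative (form c) (at p) v \<bullet> w = frechet_derivative (form c) (at p) w \<bullet> v"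
  shows "X \<in> span {b}"
proof -
  obtain c where c: "c \<in> A" "\<one> \<in> cdom c"
    using chart_at topspace_eq by blast
  have orth: "g \<one> (X \<one>) (z \<one>) = 0" if z: "z \<in> U" for z
  proof -
    have "form c (cmap c \<one>) \<bullet> lie_bracket A b z \<one> c = 0"
      using form_derivative_bracket[OF b(1) U_lie_algebra[OF z] c] closed[OF c(1)] c(2) by simp
    then show ?thesis
      using form_chart[OF c equivariant_tangent[OF U_equivariant[OF z] one_closed]] bracket_b[OF z]
      by simp
  qed
  obtain r z where z: "z \<in> U" "X = r *\<^sub>R b + z"
    using decomposition[OF X_equivariant] by blast
  have zt: "z \<one> \<in> tangent_space A \<one>"
    using equivariant_tangent[OF U_equivariant[OF z(1)] one_closed] .
  have "g \<one> (X \<one>) (z \<one>) = g \<one> (r *\<^sub>R b \<one> + z \<one>) (z \<one>)"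
    by (simp add: z(2) scaleR_fun_def)
  also have "\<dots> = r * g \<one> (b \<one>) (z \<one>) + g \<one> (z \<one>) (z \<one>)"
    by (rule metric_add_scale[OF one_closed equivariant_tangent[OF b_equivariant one_closed] zt zt])
  finally have "g \<one> (z \<one>) (z \<one>) = 0"
    using orth[OF z(1)] b_orth[OF z(1)] by simp
  then have "z \<one> = 0"
    using metric_pos[OF one_closed zt] by force
  then have "z = 0"
    using equivariant_eqI[OF U_equivariant[OF z(1)] subspace_0[OF subspace_equivariant]] by simp
  then show ?thesis
    using z(2) by (simp add: span_mul span_base)
qed

end

theorem theorem4p2:
  fixes G :: "('a, 'm) monoid_scheme"
    and T :: "'a topology"
    and A :: "('a, real ^ 'n) chart set"
    and b X :: "'a \<Rightarrow> ('a, real ^ 'n) tangent"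
    and U :: "('a \<Rightarrow> ('a, real ^ 'n) tangent) set"
    and g :: "'a \<Rightarrow> ('a, real ^ 'n) tangent \<Rightarrow> ('a, real ^ 'n) tangent \<Rightarrow> real"
    and F :: "'a \<Rightarrow> ('a, real ^ 'n) tangent \<Rightarrow> real"
  assumes "class_G1 G T A"
    and "b \<in> lie_algebra G A"
    and "lie_ideal G A U" and "commutative_subset A U" and "codim_one G A U"
    and "\<forall>z\<in>U. lie_bracket A b z = z"
    and "left_invariant_riemannian_metric G A g"
    and "b \<noteq> 0" and "\<forall>z\<in>U. g \<one>\<^bsub>G\<^esub> (b \<one>\<^bsub>G\<^esub>) (z \<one>\<^bsub>G\<^esub>) = 0"
    and "left_invariant_field G A X"
    and "\<forall>x\<in>carrier G. \<forall>y\<in>tangent_space A x. F x y = randers g X x y"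
    and "finsler_metric A F" and "left_invariant_finsler G A F"
  shows "douglas A F \<longleftrightarrow> X \<in> span {b}"
proof -
  interpret lie_group G T A
    using assms(1) unfolding class_G1_def by blast
  interpret G1_randers G T A g X b U
    using assms by unfold_locales auto
  have "douglas A F \<longleftrightarrow> (\<forall>c\<in>A. \<forall>p\<in>cran c. \<forall>v w.
      frechet_derivative (form c) (at p) v \<bullet> w = frechet_derivative (form c) (at p) w \<bullet> v)"
    unfolding douglas_def
  proof (rule ball_cong[OF refl])
    fix c assume "c \<in> A"
    then interpret local_randers A F c "cran c" "gram c" "form c"
      using local_randersI assms by blast
    show "(\<exists>(\<Gamma> :: real ^ 'n \<Rightarrow> 'n \<Rightarrow> 'n \<Rightarrow> 'n \<Rightarrow> real) (P :: real ^ 'n \<Rightarrow> real ^ 'n \<Rightarrow> real).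
       (\<forall>p\<in>cran c. \<forall>y r. y \<noteq> 0 \<longrightarrow> r > 0 \<longrightarrow> P p (r *\<^sub>R y) = r * P p y) \<and>
       (\<forall>p\<in>cran c. \<forall>y i. y \<noteq> 0 \<longrightarrow>
          spray A F c i p y
            = 1/2 * (\<Sum>j\<in>UNIV. \<Sum>k\<in>UNIV. \<Gamma> p i j k * y $ j * y $ k) + P p y * y $ i))
      \<longleftrightarrow> (\<forall>p\<in>cran c. \<forall>v w.
        frechet_derivative (form c) (at p) v \<bullet> w = frechet_derivative (form c) (at p) w \<bullet> v)"
      using douglas_iff_closed unfolding D\<beta>_def .
  qed
  also have "\<dots> \<longleftrightarrow> X \<in> span {b}"
    using span_b_imp_closed closed_imp_span_b by blast
  finally show ?thesis .
qed

end
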